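(* Let $R^+(x;t)=\sum_{n\ge 0}R_n^+(x)\frac{t^n}{n!}$ and $R^-(x;t)=\sum_{n\ge 0}R_n^-(x)\frac{t^n}{n!}$ be the exponential generating functions of the descent polynomials of signed simsun permutations with positive, respectively negative, first entry. Let $u(x,t)=t\sqrt{2x-1}-\arctan(\sqrt{2x-1})$. Then $$R^+(x;t)=\frac{\sqrt{2x-1}}{2\sqrt{x}\,p(x)}\left(p^2(x)F_2(u(x,t))+F_1(u(x,t))\right),$$ $$R^-(x;t)=\frac{-\sqrt{2x-1}}{2p(x)}\left(p^2(x)F_2(u(x,t))-F_1(u(x,t))\right),$$ where $$p(x)=\left(\frac{\sqrt{2x}+1}{\sqrt{2x}-1}\right)^{\frac{\sqrt{2}}{4}}$$ and $$F_1(y)=\frac{-1}{\sqrt{2}\sin(y)}\left(\frac{-\sin(y)}{1+\cos(y)}\right)^{-\frac{1}{\sqrt{2}}},\qquad F_2(y)=\frac{-1}{\sqrt{2}\sin(y)}\left(\frac{-\sin(y)}{1+\cos(y)}\right)^{\frac{1}{\sqrt{2}}}.$$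
   Context: Let $[n]=\{1,\dots,n\}$ and let $B_n$ be the group of signed permutations: permutations $\pi$ of $\{\pm1,\dots,\pm n\}$ with $\pi(-i)=-\pi(i)$. Each $\pi\in B_n$ is identified with the word $\pi(0)\pi(1)\cdots\pi(n)$, where $\pi(0)=0$. A double descent of $\pi\in B_n$ is an index $i\in[n-1]$ with $\pi(i-1)>\pi(i)>\pi(i+1)$ (so $i=1$ uses $\pi(0)=0$). A permutation $\pi\in B_n$ is a signed simsun permutation if for every $0\le k\le n$, the word obtained from $\pi$ by removing the $k$ entries $\pm n,\pm(n-1),\dots,\pm(n-k+1)$ (keeping the leading $0$ and the order of the remaining entries) is a signed permutation in $B_{n-k}$ with no double descents. Let $\mathcal{RB}_n$ be the set of signed simsun permutations in $B_n$, $\mathcal{RB}_n^+=\{\pi\in\mathcal{RB}_n:\pi(1)>0\}$ and $\mathcal{RB}_n^-=\{\pi\in\mathcal{RB}_n:\pi(1)<0\}$. The type $B$ descent number is $\mathrm{des}_B(\pi)=|\{i\in\{0,1,\dots,n-1\}:\pi(i)>\pi(i+1)\}|$. For $n\ge1$ define $R_n^{+}(x)=\sum_{\pi\in\mathcal{RB}_n^{+}}x^{\mathrm{des}_B(\pi)}$ and $R_n^{-}(x)=\sum_{\pi\in\mathcal{RB}_n^{-}}x^{\mathrm{des}_B(\pi)}$; by convention $R_0^+(x)=1$ and $R_0^-(x)=0$. The identities are equalities of power series in $t$ (right-hand sides expanded around $t=0$), the displayed real roots and powers being read where they are defined, i.e. for real $x>1/2$. *)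

theory Defs
  imports
    "HOL-Analysis.Analysis"
    "HOL-Combinatorics.Permutations"
    "HOL-Computational_Algebra.Polynomial"
begin

(* A signed permutation is a function on all integers; "permutes" makes it the identity
   outside {-n..n} - {0}, so that functions and signed permutations correspond one to one
   and the convention \<pi> 0 = 0 holds automatically. *)
definition signed_perms :: "nat \<Rightarrow> (int \<Rightarrow> int) set" where
  "signed_perms n =
    {\<pi>. \<pi> permutes ({- int n..int n} - {0}) \<and> (\<forall>i\<in>{- int n..int n} - {0}. \<pi> (- i) = - \<pi> i)}"

definition sp_word :: "nat \<Rightarrow> (int \<Rightarrow> int) \<Rightarrow> int list" where
  "sp_word n \<pi> = map \<pi> [0..int n]"

definition double_descent :: "nat \<Rightarrow> (int \<Rightarrow> int) \<Rightarrow> int \<Rightarrow> bool" where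
  "double_descent n \<pi> i \<longleftrightarrow> i \<in> {1..int n - 1} \<and> \<pi> (i - 1) > \<pi> i \<and> \<pi> i > \<pi> (i + 1)"

definition remove_largest :: "nat \<Rightarrow> nat \<Rightarrow> int list \<Rightarrow> int list" where
  "remove_largest n k w = filter (\<lambda>v. \<bar>v\<bar> \<notin> {int n - int k + 1..int n}) w"

definition signed_simsun :: "nat \<Rightarrow> (int \<Rightarrow> int) set" where
  "signed_simsun n = {\<pi> \<in> signed_perms n. \<forall>k\<le>n. \<exists>\<sigma>\<in>signed_perms (n - k).
      sp_word (n - k) \<sigma> = remove_largest n k (sp_word n \<pi>) \<and>
      (\<nexists>i. double_descent (n - k) \<sigma> i)}"

definition signed_simsun_pos :: "nat \<Rightarrow> (int \<Rightarrow> int) set" where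
  "signed_simsun_pos n = {\<pi> \<in> signed_simsun n. \<pi> 1 > 0}"

definition signed_simsun_neg :: "nat \<Rightarrow> (int \<Rightarrow> int) set" where
  "signed_simsun_neg n = {\<pi> \<in> signed_simsun n. \<pi> 1 < 0}"

definition des_B :: "nat \<Rightarrow> (int \<Rightarrow> int) \<Rightarrow> nat" where
  "des_B n \<pi> = card {i \<in> {0..int n - 1}. \<pi> i > \<pi> (i + 1)}"

definition R_pos :: "nat \<Rightarrow> real poly" where
  "R_pos n = (if n = 0 then 1 else (\<Sum>\<pi>\<in>signed_simsun_pos n. monom 1 (des_B n \<pi>)))"

definition R_neg :: "nat \<Rightarrow> real poly" where
  "R_neg n = (if n = 0 then 0 else (\<Sum>\<pi>\<in>signed_simsun_neg n. monom 1 (des_B n \<pi>)))"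

definition egf_pos :: "real \<Rightarrow> real fps" where
  "egf_pos x = Abs_fps (\<lambda>n. poly (R_pos n) x / fact n)"

definition egf_neg :: "real \<Rightarrow> real fps" where
  "egf_neg x = Abs_fps (\<lambda>n. poly (R_neg n) x / fact n)"

definition u_fun :: "real \<Rightarrow> real \<Rightarrow> real" where
  "u_fun x t = t * sqrt (2 * x - 1) - arctan (sqrt (2 * x - 1))"

definition p_fun :: "real \<Rightarrow> real" where
  "p_fun x = ((sqrt (2 * x) + 1) / (sqrt (2 * x) - 1)) powr (sqrt 2 / 4)"

definition F1 :: "real \<Rightarrow> real" where
  "F1 y = - 1 / (sqrt 2 * sin y) * (- sin y / (1 + cos y)) powr (- (1 / sqrt 2))"

definition F2 :: "real \<Rightarrow> real" where
  "F2 y = - 1 / (sqrt 2 * sin y) * (- sin y / (1 + cos y)) powr (1 / sqrt 2)"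

end

theory Submission
  imports Defs "HOL-Complex_Analysis.Complex_Analysis"
begin

text \<open>
  The proof compares two recurrences in \<open>n\<close>.

  \<^emph>\<open>Combinatorial side.\<close> A signed simsun word of size \<open>n + 1\<close> arises from exactly one of size
  \<open>n\<close> by inserting \<open>n + 1\<close> or \<open>- (n + 1)\<close> behind the leading \<open>0\<close> without creating a double
  descent (\<open>sum_simsun_words_Suc\<close>). The number of admissible positions that keep, respectively
  raise, the number of descents depends only on \<open>n\<close>, on the number of descents, and on the sign of
  the first entry (\<open>children_sum_pos_first\<close>, \<open>children_sum_neg_first\<close>). Summing up gives
  \<open>R_pos_Suc\<close> and \<open>R_neg_Suc\<close>, that is, with \<open>L f = 2 x (1 - 2 x) f'\<close>,
  \<open>R\<^sup>+\<^bsub>n+1\<^esub> = L R\<^sup>+\<^bsub>n\<^esub> + (1 + 2 n x) R\<^sup>+\<^bsub>n\<^esub> + R\<^sup>-\<^bsub>n\<^esub>\<close> and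
  \<open>R\<^sup>-\<^bsub>n+1\<^esub> = L R\<^sup>-\<^bsub>n\<^esub> + 2 (n + 1) x R\<^sup>-\<^bsub>n\<^esub> + x R\<^sup>+\<^bsub>n\<^esub>\<close>.

  \<^emph>\<open>Analytic side.\<close> Let \<open>s = sqrt (2 x - 1)\<close> and \<open>y = - arctan s\<close>, the value of \<open>u\<close> at
  \<open>t = 0\<close>. The \<open>n\<close>-th \<open>t\<close>-derivatives of the claimed closed forms at \<open>t = 0\<close> are combinations
  of \<open>T\<^sup>+\<^bsub>n\<^esub> = s\<^bsup>n+1\<^esup> p F\<^sub>2\<^bsup>(n)\<^esup>(y) / 2\<close> and \<open>T\<^sup>-\<^bsub>n\<^esub> = s\<^bsup>n+1\<^esup> p\<^bsup>-1\<^esup> F\<^sub>1\<^bsup>(n)\<^esup>(y) / 2\<close>. Since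
  \<open>L y = s\<close>, \<open>L s = - 2 x s\<close> and \<open>L p = sqrt x * p\<close>, they satisfy
  \<open>L T\<^sup>\<plusminus>\<^bsub>n\<^esub> = T\<^sup>\<plusminus>\<^bsub>n+1\<^esub> - (2 (n + 1) x \<mp> sqrt x) T\<^sup>\<plusminus>\<^bsub>n\<^esub>\<close> (\<open>taylor_term_derivative\<close>).
  The combinations \<open>sqrt x * R\<^sup>+\<^bsub>n\<^esub> = T\<^sup>+\<^bsub>n\<^esub> + T\<^sup>-\<^bsub>n\<^esub>\<close> and \<open>R\<^sup>-\<^bsub>n\<^esub> = T\<^sup>-\<^bsub>n\<^esub> - T\<^sup>+\<^bsub>n\<^esub>\<close> turn
  these two first-order recurrences into the combinatorial ones, so both identities follow by
  induction on \<open>n\<close>, simultaneously for all \<open>x > 1 / 2\<close> (\<open>R_closed_form\<close>); the base case says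
  that \<open>tan (arctan s / 2)\<close> is \<open>p\<close> to the power \<open>- sqrt 2\<close> (\<open>half_angle_value\<close>).

  That \<open>F\<^sub>1\<close> and \<open>F\<^sub>2\<close> are the sums of their Taylor series near \<open>y\<close> is inherited from
  holomorphic extensions (\<open>has_fps_expansion_real_higher_deriv\<close>).
\<close>

section \<open>Inserting a letter of largest absolute value\<close>

fun des :: "int list \<Rightarrow> nat" where
  "des (a # b # v) = (if a > b then 1 else 0) + des (b # v)"
| "des v = 0"

fun no_double_des :: "int list \<Rightarrow> bool" where
  "no_double_des (a # b # c # v) \<longleftrightarrow> \<not> (a > b \<and> b > c) \<and> no_double_des (b # c # v)"
| "no_double_des v \<longleftrightarrow> True"

fun insertions :: "'a \<Rightarrow> 'a list \<Rightarrow> 'a list list" where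
  "insertions e [] = [[e]]"
| "insertions e (b # v) = (e # b # v) # map (Cons b) (insertions e v)"

text \<open>
  Words with a double descent get weight \<open>0\<close>, so sums may range over all insertions, admissible
  or not.
\<close>

definition weight :: "real \<Rightarrow> int list \<Rightarrow> real" where
  "weight x w = (if no_double_des w then x ^ des w else 0)"

lemma no_double_des_tl: "no_double_des (a # v) \<Longrightarrow> no_double_des v"
  by (cases "a # v" rule: no_double_des.cases) auto

text \<open>
  Prepending a letter in front of \<open>b\<close> is harmless unless it creates a descent to \<open>b\<close> that \<open>u\<close>
  continues.
\<close>

lemma weight_Cons_Cons:
  assumes "a > b \<Longrightarrow> u \<noteq> [] \<Longrightarrow> b \<le> hd u"
  shows "weight x (a # b # u) = (if a > b then x else 1) * weight x (b # u)"
  using assms by (cases u) (auto simp: weight_def)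

text \<open>
  A new maximum does not change the number of descents exactly at the end of the word or inside a
  descent; since there are no double descents, these \<open>1 + des\<close> places are all admissible. Inside a
  non-descent it adds one descent, and this is admissible unless the next pair is a descent. Every
  descent other than one at the very beginning blocks one place in this way, which leaves
  \<open>length v - 2 * des\<close> places, plus one if the word starts with a descent.
\<close>

lemma sum_weight_insert_max:
  assumes "\<forall>b\<in>set (a # v). b < M" "no_double_des (a # v)"
  shows "(\<Sum>u\<leftarrow>insertions M v. weight x (a # u)) =
     (1 + real (des (a # v))) * x ^ des (a # v) +
     (real (length v) - 2 * real (des (a # v)) + (if v \<noteq> [] \<and> hd v < a then 1 else 0)) * x ^ Suc (des (a # v))"
  using assms
proof (induction v arbitrary: a)
  case Nil
  then show ?case by (simp add: weight_def)
next
  case (Cons b v)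
  have "no_double_des (b # v)" using Cons.prems(2) no_double_des_tl by blast
  with Cons have IH: "(\<Sum>u\<leftarrow>insertions M v. weight x (b # u)) =
     (1 + real (des (b # v))) * x ^ des (b # v) +
     (real (length v) - 2 * real (des (b # v)) + (if v \<noteq> [] \<and> hd v < b then 1 else 0)) * x ^ Suc (des (b # v))"
    by simp
  have shift: "weight x (a # b # u) = (if a > b then x else 1) * weight x (b # u)"
    if u: "u \<in> set (insertions M v)" for u
  proof (rule weight_Cons_Cons)
    assume "a > b"
    then show "b \<le> hd u" using u Cons.prems by (cases v) auto
  qed
  have first: "weight x (a # M # b # v) =
      (if v \<noteq> [] \<and> hd v < b then 0 else x ^ Suc (des (b # v)))"
    using Cons.prems by (cases v) (auto simp: weight_def)
  have "(\<Sum>u\<leftarrow>insertions M (b # v). weight x (a # u)) =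
      weight x (a # M # b # v) + (\<Sum>u\<leftarrow>insertions M v. weight x (a # b # u))"
    by (simp add: comp_def)
  also have "(\<Sum>u\<leftarrow>insertions M v. weight x (a # b # u)) =
      (if a > b then x else 1) * (\<Sum>u\<leftarrow>insertions M v. weight x (b # u))"
    by (simp add: shift sum_list_const_mult cong: map_cong)
  finally show ?case
    using Cons.prems unfolding first IH by (cases v) (auto simp: algebra_simps)
qed

lemma insertions_eq: "insertions e v = (e # v) # tl (insertions e v)"
  by (cases v) auto

text \<open>
  A new minimum keeps the number of descents exactly inside a descent. Otherwise, also at the end of
  the word, it adds one, and is admissible unless the preceding pair is a descent. The place right
  behind the first letter is left out of the sum: it is the only one that affects the sign of the
  first entry, and in the induction its admissibility depends on the letter before.
\<close>

lemma sum_weight_insert_min: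
  assumes "\<forall>b\<in>set (a # v). m < b" "no_double_des (a # v)"
  shows "(\<Sum>u\<leftarrow>tl (insertions m v). weight x (a # u)) =
     (real (des (a # v)) - (if v \<noteq> [] \<and> hd v < a then 1 else 0)) * x ^ des (a # v) +
     (real (length v) - 2 * real (des (a # v)) + (if v \<noteq> [] \<and> hd v < a then 1 else 0)) * x ^ Suc (des (a # v))"
  using assms
proof (induction v arbitrary: a)
  case Nil
  then show ?case by (simp add: weight_def)
next
  case (Cons b v)
  have nd: "no_double_des (b # v)" using Cons.prems(2) no_double_des_tl by blast
  with Cons have IH: "(\<Sum>u\<leftarrow>tl (insertions m v). weight x (b # u)) =
     (real (des (b # v)) - (if v \<noteq> [] \<and> hd v < b then 1 else 0)) * x ^ des (b # v) +
     (real (length v) - 2 * real (des (b # v)) + (if v \<noteq> [] \<and> hd v < b then 1 else 0)) * x ^ Suc (des (b # v))"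
    by simp
  have shift: "weight x (a # b # u) = (if a > b then x else 1) * weight x (b # u)"
    if u: "u \<in> set (tl (insertions m v))" for u
  proof (rule weight_Cons_Cons)
    assume "a > b"
    then show "b \<le> hd u" using u Cons.prems by (cases v) auto
  qed
  have first: "weight x (a # b # m # v) =
      (if a > b then 0 else if v \<noteq> [] \<and> hd v < b then x ^ des (b # v) else x ^ Suc (des (b # v)))"
    using Cons.prems nd by (cases v) (auto simp: weight_def elim: no_double_des.elims)
  have "(\<Sum>u\<leftarrow>tl (insertions m (b # v)). weight x (a # u)) =
      (\<Sum>u\<leftarrow>insertions m v. weight x (a # b # u))"
    by (simp add: comp_def)
  also have "\<dots> = weight x (a # b # m # v) + (\<Sum>u\<leftarrow>tl (insertions m v). weight x (a # b # u))"
    by (subst insertions_eq) simp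
  also have "(\<Sum>u\<leftarrow>tl (insertions m v). weight x (a # b # u)) =
      (if a > b then x else 1) * (\<Sum>u\<leftarrow>tl (insertions m v). weight x (b # u))"
    by (simp add: shift sum_list_const_mult cong: map_cong)
  finally show ?case
    using Cons.prems unfolding first IH by (cases v) (auto simp: algebra_simps)
qed

definition children_sum :: "(int list \<Rightarrow> real) \<Rightarrow> int \<Rightarrow> int list \<Rightarrow> real" where
  "children_sum f M v = (\<Sum>u\<leftarrow>insertions M v. f u) + (\<Sum>u\<leftarrow>insertions (- M) v. f u)"

text \<open>
  The first entry of a child is the inserted letter if that goes to the front, and otherwise the
  first entry of the parent. So a word with positive first entry has a single child with negative
  first entry, and vice versa. The empty word counts as positive, in accordance with
  \<open>R_pos 0 = 1\<close>.
\<close>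

lemma children_sum_pos_first:
  assumes "\<forall>b\<in>set v. \<bar>b\<bar> < M" "0 < M" "no_double_des (0 # v)" "v \<noteq> [] \<Longrightarrow> 0 < hd v"
  shows "children_sum (\<lambda>u. if 0 < hd u then weight x (0 # u) else 0) M v =
      (1 + 2 * real (des (0 # v))) * x ^ des (0 # v) +
      2 * (real (length v) - 2 * real (des (0 # v))) * x ^ Suc (des (0 # v))" (is "?A = _")
    and "children_sum (\<lambda>u. if hd u < 0 then weight x (0 # u) else 0) M v = x ^ Suc (des (0 # v))" (is "?B = _")
proof -
  have mx: "(\<Sum>u\<leftarrow>insertions M v. weight x (0 # u)) =
     (1 + real (des (0 # v))) * x ^ des (0 # v) +
     (real (length v) - 2 * real (des (0 # v))) * x ^ Suc (des (0 # v))"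
    using assms by (subst sum_weight_insert_max) auto
  have mn: "(\<Sum>u\<leftarrow>tl (insertions (- M) v). weight x (0 # u)) =
     real (des (0 # v)) * x ^ des (0 # v) +
     (real (length v) - 2 * real (des (0 # v))) * x ^ Suc (des (0 # v))"
    using assms by (subst sum_weight_insert_min) (auto simp: abs_if split: if_splits)
  have hdM: "0 < hd u" if "u \<in> set (insertions M v)" for u
    using that assms by (cases v) auto
  have hdm: "0 < hd u" if "u \<in> set (tl (insertions (- M) v))" for u
    using that assms by (cases v) auto
  have s: "insertions (- M) v = (- M # v) # tl (insertions (- M) v)" by (rule insertions_eq)
  have first: "weight x (0 # - M # v) = x ^ Suc (des (0 # v))"
    using assms by (cases v; cases "tl v") (auto simp: weight_def)
  have "?A = (\<Sum>u\<leftarrow>insertions M v. weight x (0 # u)) + (\<Sum>u\<leftarrow>tl (insertions (- M) v). weight x (0 # u))"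
    unfolding children_sum_def using assms(2) by (subst s) (auto simp: hdM hdm cong: map_cong)
  then show "?A = (1 + 2 * real (des (0 # v))) * x ^ des (0 # v) +
      2 * (real (length v) - 2 * real (des (0 # v))) * x ^ Suc (des (0 # v))"
    unfolding mx mn by (simp add: algebra_simps)
  have not_neg: "\<not> hd u < 0" if "u \<in> set (insertions M v) \<union> set (tl (insertions (- M) v))" for u
    using that hdM[of u] hdm[of u] by auto
  have "?B = weight x (0 # - M # v)"
    unfolding children_sum_def using assms(2)
    by (subst s) (simp add: not_neg cong: map_cong)
  then show "?B = x ^ Suc (des (0 # v))" unfolding first .
qed

lemma children_sum_neg_first:
  assumes "\<forall>b\<in>set v. \<bar>b\<bar> < M" "0 < M" "no_double_des (0 # v)" "v \<noteq> []" "hd v < 0"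
  shows "children_sum (\<lambda>u. if 0 < hd u then weight x (0 # u) else 0) M v = x ^ des (0 # v)" (is "?A = _")
    and "children_sum (\<lambda>u. if hd u < 0 then weight x (0 # u) else 0) M v =
      2 * real (des (0 # v)) * x ^ des (0 # v) +
      2 * (real (length v) + 1 - 2 * real (des (0 # v))) * x ^ Suc (des (0 # v))" (is "?B = _")
proof -
  obtain b v' where v: "v = b # v'" using assms(4) by (cases v) auto
  have M: "insertions M v = (M # v) # tl (insertions M v)"
    and m: "insertions (- M) v = (- M # v) # tl (insertions (- M) v)" by (rule insertions_eq)+
  have firstM: "weight x (0 # M # v) = x ^ des (0 # v)"
    using assms unfolding v by (cases v') (auto simp: weight_def)
  have firstm: "weight x (0 # - M # v) = x ^ des (0 # v)"
    using assms unfolding v by (cases v') (auto simp: weight_def)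
  have "(\<Sum>u\<leftarrow>insertions M v. weight x (0 # u)) =
     (1 + real (des (0 # v))) * x ^ des (0 # v) +
     (real (length v) - 2 * real (des (0 # v)) + 1) * x ^ Suc (des (0 # v))"
    using assms by (subst sum_weight_insert_max) auto
  then have mx: "(\<Sum>u\<leftarrow>tl (insertions M v). weight x (0 # u)) =
     real (des (0 # v)) * x ^ des (0 # v) +
     (real (length v) - 2 * real (des (0 # v)) + 1) * x ^ Suc (des (0 # v))"
    by (subst (asm) M) (simp add: firstM algebra_simps)
  have mn: "(\<Sum>u\<leftarrow>tl (insertions (- M) v). weight x (0 # u)) =
     (real (des (0 # v)) - 1) * x ^ des (0 # v) +
     (real (length v) - 2 * real (des (0 # v)) + 1) * x ^ Suc (des (0 # v))"
    using assms by (subst sum_weight_insert_min) (auto simp: abs_if split: if_splits)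
  have hdM: "hd u < 0" if "u \<in> set (tl (insertions M v))" for u
    using that assms by (auto simp: v)
  have hdm: "hd u < 0" if "u \<in> set (tl (insertions (- M) v))" for u
    using that assms by (auto simp: v)
  have not_pos: "\<not> 0 < hd u" if "u \<in> set (tl (insertions M v)) \<union> set (tl (insertions (- M) v))" for u
    using that hdM[of u] hdm[of u] by auto
  have "?A = weight x (0 # M # v)"
    unfolding children_sum_def using assms(2)
    by (subst M, subst m) (simp add: not_pos cong: map_cong)
  then show "?A = x ^ des (0 # v)" unfolding firstM .
  have "?B = (\<Sum>u\<leftarrow>tl (insertions M v). weight x (0 # u)) +
      (weight x (0 # - M # v) + (\<Sum>u\<leftarrow>tl (insertions (- M) v). weight x (0 # u)))"
    unfolding children_sum_def using assms(2)
    by (subst M, subst m) (auto simp: hdM hdm cong: map_cong)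
  then show "?B = 2 * real (des (0 # v)) * x ^ des (0 # v) +
      2 * (real (length v) + 1 - 2 * real (des (0 # v))) * x ^ Suc (des (0 # v))"
    unfolding mx mn firstm by (simp add: algebra_simps)
qed

section \<open>Signed simsun permutations as words\<close>

lemma des_eq_card: "des w = card {i. Suc i < length w \<and> w ! Suc i < w ! i}"
proof (induction w rule: des.induct)
  case (1 a b v)
  have "{i. Suc i < length (a # b # v) \<and> (a # b # v) ! Suc i < (a # b # v) ! i} =
      (if a > b then {0} else {}) \<union> Suc ` {i. Suc i < length (b # v) \<and> (b # v) ! Suc i < (b # v) ! i}"
    (is "?L = ?R")
  proof (rule set_eqI)
    fix i show "i \<in> ?L \<longleftrightarrow> i \<in> ?R" by (cases i) auto
  qed
  moreover have "finite {i. Suc i < length (b # v) \<and> (b # v) ! Suc i < (b # v) ! i}"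
    by (rule finite_subset[of _ "{..<length (b # v)}"]) auto
  ultimately show ?case using 1
    by (auto simp: card_image card_insert_if)
qed auto

lemma no_double_des_iff_nth:
  "no_double_des w \<longleftrightarrow>
    (\<forall>i. Suc (Suc i) < length w \<longrightarrow> \<not> (w ! i > w ! Suc i \<and> w ! Suc i > w ! Suc (Suc i)))"
proof (induction w rule: no_double_des.induct)
  case (1 a b c v)
  show ?case (is "_ \<longleftrightarrow> (\<forall>i. ?P i)")
  proof -
    have "(\<forall>i. ?P i) \<longleftrightarrow> ?P 0 \<and> (\<forall>i. ?P (Suc i))" by (metis not0_implies_Suc)
    then show ?thesis using 1 by simp
  qed
qed auto

text \<open>
  The value words \<open>\<pi>(1), \<dots>, \<pi>(n)\<close> of signed permutations: as there are only \<open>n\<close> letters,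
  surjectivity onto the absolute values forces these to be distinct.
\<close>

definition signed_word :: "nat \<Rightarrow> int list \<Rightarrow> bool" where
  "signed_word n v \<longleftrightarrow> length v = n \<and> abs ` set v = {1..int n}"

lemma signed_word_distinct_abs:
  assumes "signed_word n v" shows "distinct (map abs v)"
proof (rule card_distinct)
  show "card (set (map abs v)) = length (map abs v)" using assms by (simp add: signed_word_def)
qed

lemma signed_word_filter:
  assumes v: "signed_word n v" and "m \<le> n"
  shows "signed_word m (filter (\<lambda>a. \<bar>a\<bar> \<le> int m) v)" (is "signed_word m ?f")
proof -
  have "abs ` set ?f = {a \<in> abs ` set v. a \<le> int m}" by auto
  then have s: "abs ` set ?f = {1..int m}" using v assms(2) by (auto simp: signed_word_def)
  have "distinct (map abs ?f)"
    using signed_word_distinct_abs[OF v] by (simp add: distinct_map inj_on_def)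
  then have "length ?f = card (abs ` set ?f)" by (metis distinct_card length_map list.set_map)
  with s show ?thesis by (simp add: signed_word_def)
qed

lemma signed_perms_word:
  assumes "\<pi> \<in> signed_perms n"
  shows "sp_word n \<pi> = 0 # map \<pi> [1..int n]" and "signed_word n (map \<pi> [1..int n])"
proof -
  let ?S = "{- int n..int n} - {0}"
  have p: "\<pi> permutes ?S"
    and odd: "\<forall>i\<in>?S. \<pi> (- i) = - \<pi> i"
    using assms by (auto simp: signed_perms_def)
  have "\<pi> 0 = 0" using permutes_not_in[OF p, of 0] by simp
  then show "sp_word n \<pi> = 0 # map \<pi> [1..int n]" by (simp add: sp_word_def upto.simps[of 0])
  have "k \<in> abs ` \<pi> ` {1..int n}" if k: "k \<in> {1..int n}" for k
  proof -
    have "k \<in> ?S" using k by auto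
    then have "k \<in> \<pi> ` ?S" unfolding permutes_image[OF p] .
    then obtain j where j: "j \<in> ?S" "\<pi> j = k" by blast
    show ?thesis
    proof (cases "0 < j")
      case True
      then have "j \<in> {1..int n}" "k = \<bar>\<pi> j\<bar>" using j k by auto
      then show ?thesis by blast
    next
      case False
      then have "- j \<in> {1..int n}" "\<bar>\<pi> (- j)\<bar> = k" using j odd k by auto
      then show ?thesis by (metis image_eqI)
    qed
  qed
  moreover have "\<bar>\<pi> i\<bar> \<in> {1..int n}" if "i \<in> {1..int n}" for i
    using permutes_in_image[OF p, of i] that by auto
  ultimately have "abs ` \<pi> ` {1..int n} = {1..int n}" by blast
  then show "signed_word n (map \<pi> [1..int n])" by (simp add: signed_word_def)
qed

text \<open>
  A signed permutation is determined by its values on \<open>1, \<dots>, n\<close>, being odd on the nonzero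
  integers up to \<open>n\<close> in absolute value and the identity elsewhere.
\<close>

lemma bij_betw_signed_perms_words:
  "bij_betw (\<lambda>\<pi>. map \<pi> [1..int n]) (signed_perms n) {v. signed_word n v}"
proof (rule bij_betwI')
  fix \<pi> \<sigma> assume *: "\<pi> \<in> signed_perms n" "\<sigma> \<in> signed_perms n"
  show "map \<pi> [1..int n] = map \<sigma> [1..int n] \<longleftrightarrow> \<pi> = \<sigma>"
  proof
    assume "map \<pi> [1..int n] = map \<sigma> [1..int n]"
    then have eq: "\<pi> i = \<sigma> i" if "i \<in> {1..int n}" for i using that by simp
    show "\<pi> = \<sigma>"
    proof
      fix i
      consider "i \<notin> {- int n..int n} - {0}" | "i \<in> {1..int n}" | "- i \<in> {1..int n}" by force
      then show "\<pi> i = \<sigma> i"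
      proof cases
        case 1
        then show ?thesis using * by (metis (mono_tags, lifting) mem_Collect_eq permutes_not_in signed_perms_def)
      next
        case 3
        then have "- i \<in> {- int n..int n} - {0}" by auto
        then have "\<pi> (- (- i)) = - \<pi> (- i)" "\<sigma> (- (- i)) = - \<sigma> (- i)"
          using * unfolding signed_perms_def by blast+
        then show ?thesis using eq[OF 3] by simp
      qed (rule eq)
    qed
  qed simp
next
  fix \<pi> assume "\<pi> \<in> signed_perms n"
  then show "map \<pi> [1..int n] \<in> {v. signed_word n v}" using signed_perms_word by simp
next
  fix v assume "v \<in> {v. signed_word n v}"
  then have v: "signed_word n v" by simp
  then have len: "length v = n" by (simp add: signed_word_def)
  let ?S = "{- int n..int n} - {0}"
  \<comment> \<open>the odd extension of the word; list indices start at \<open>0\<close>\<close>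
  define \<pi> where "\<pi> i = (if i \<in> ?S then sgn i * v ! (nat \<bar>i\<bar> - 1) else i)" for i
  have idx: "nat \<bar>i\<bar> - 1 < length v" if "i \<in> ?S" for i
    using that len by (simp add: nat_less_iff) arith
  have entry: "\<bar>v ! (nat \<bar>i\<bar> - 1)\<bar> \<in> {1..int n}" if "i \<in> ?S" for i
  proof -
    have "v ! (nat \<bar>i\<bar> - 1) \<in> set v" using that len by (intro nth_mem) auto
    then show ?thesis using v by (auto simp: signed_word_def)
  qed
  have "inj_on \<pi> ?S"
  proof (rule inj_onI)
    fix i j assume ij: "i \<in> ?S" "j \<in> ?S" "\<pi> i = \<pi> j"
    then have e: "sgn i * v ! (nat \<bar>i\<bar> - 1) = sgn j * v ! (nat \<bar>j\<bar> - 1)" by (simp add: \<pi>_def)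
    have "\<bar>sgn i * a\<bar> = \<bar>a\<bar>" "\<bar>sgn j * a\<bar> = \<bar>a\<bar>" for a :: int
      using ij by (auto simp: abs_mult)
    with e have "\<bar>v ! (nat \<bar>i\<bar> - 1)\<bar> = \<bar>v ! (nat \<bar>j\<bar> - 1)\<bar>" by metis
    then have "map abs v ! (nat \<bar>i\<bar> - 1) = map abs v ! (nat \<bar>j\<bar> - 1)"
      using idx[OF ij(1)] idx[OF ij(2)] by simp
    then have "nat \<bar>i\<bar> - 1 = nat \<bar>j\<bar> - 1"
      using signed_word_distinct_abs[OF v] idx[OF ij(1)] idx[OF ij(2)]
      by (simp only: nth_eq_iff_index_eq length_map)
    moreover have "0 < nat \<bar>i\<bar>" "0 < nat \<bar>j\<bar>" using ij(1,2) by simp_all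
    ultimately have "nat \<bar>i\<bar> = nat \<bar>j\<bar>" by linarith
    then have abs_eq: "\<bar>i\<bar> = \<bar>j\<bar>" by simp
    have "v ! (nat \<bar>i\<bar> - 1) \<noteq> 0" using entry[OF ij(1)] by auto
    then have "sgn i = sgn j" using e unfolding abs_eq by (simp only: mult_cancel_right simp_thms)
    then show "i = j" using abs_eq by (metis sgn_mult_abs)
  qed
  moreover have "\<pi> ` ?S \<subseteq> ?S"
  proof
    fix y assume "y \<in> \<pi> ` ?S"
    then obtain i where "i \<in> ?S" "y = \<pi> i" by blast
    then have "i \<in> ?S" "y = sgn i * v ! (nat \<bar>i\<bar> - 1)" by (simp_all add: \<pi>_def)
    then have "\<bar>y\<bar> \<in> {1..int n}" using entry[of i] by (simp add: abs_mult)
    then show "y \<in> ?S" by auto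
  qed
  ultimately have "bij_betw \<pi> ?S ?S"
    by (simp add: bij_betw_def endo_inj_surj)
  then have "\<pi> permutes ?S" by (rule bij_imp_permutes) (auto simp: \<pi>_def)
  moreover have "\<pi> (- i) = - \<pi> i" if "i \<in> ?S" for i using that by (auto simp: \<pi>_def)
  ultimately have "\<pi> \<in> signed_perms n" by (simp add: signed_perms_def)
  moreover have "v = map \<pi> [1..int n]"
    by (rule nth_equalityI) (auto simp: len \<pi>_def nat_add_distrib)
  ultimately show "\<exists>\<pi>\<in>signed_perms n. v = map \<pi> [1..int n]" by blast
qed

lemma nth_sp_word: "i \<le> n \<Longrightarrow> sp_word n \<pi> ! i = \<pi> (int i)"
  by (simp add: sp_word_def)

lemma length_sp_word: "length (sp_word n \<pi>) = Suc n"
  by (simp add: sp_word_def)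

lemma no_double_descent_iff: "(\<nexists>i. double_descent n \<pi> i) \<longleftrightarrow> no_double_des (sp_word n \<pi>)"
proof -
  have "double_descent n \<pi> i \<longleftrightarrow> (\<exists>j. i = int (Suc j) \<and> Suc (Suc j) < Suc n \<and>
      sp_word n \<pi> ! j > sp_word n \<pi> ! Suc j \<and> sp_word n \<pi> ! Suc j > sp_word n \<pi> ! Suc (Suc j))"
    (is "?L \<longleftrightarrow> ?R") for i
  proof
    assume ?L
    then show ?R unfolding double_descent_def
      by (intro exI[of _ "nat (i - 1)"]) (auto simp: nth_sp_word add.commute)
  next
    assume ?R
    then show ?L by (auto simp: double_descent_def nth_sp_word add_ac)
  qed
  then show ?thesis by (auto simp: no_double_des_iff_nth length_sp_word)
qed

lemma des_B_eq: "des_B n \<pi> = des (sp_word n \<pi>)"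
proof -
  have "{i \<in> {0..int n - 1}. \<pi> i > \<pi> (i + 1)} =
      int ` {i. Suc i < length (sp_word n \<pi>) \<and> sp_word n \<pi> ! Suc i < sp_word n \<pi> ! i}" (is "?L = ?R")
  proof (intro equalityI subsetI)
    fix i assume "i \<in> ?L"
    then show "i \<in> ?R"
      by (intro image_eqI[of _ _ "nat i"]) (auto simp: length_sp_word nth_sp_word add.commute)
  qed (auto simp: length_sp_word nth_sp_word add.commute)
  then show ?thesis by (simp add: des_B_def des_eq_card card_image)
qed

definition simsun_words :: "nat \<Rightarrow> int list set" where
  "simsun_words n =
    {v. signed_word n v \<and> (\<forall>m\<le>n. no_double_des (0 # filter (\<lambda>a. \<bar>a\<bar> \<le> int m) v))}"

lemma remove_largest_signed_word:
  assumes "signed_word n v" "k \<le> n"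
  shows "remove_largest n k (0 # v) = 0 # filter (\<lambda>a. \<bar>a\<bar> \<le> int (n - k)) v"
proof -
  have "\<bar>a\<bar> \<le> int n" if "a \<in> set v" for a using assms that by (auto simp: signed_word_def)
  then show ?thesis using assms(2) by (auto simp: remove_largest_def intro!: filter_cong)
qed

text \<open>
  Removing the \<open>k\<close> largest absolute values from a signed permutation word always leaves a signed
  permutation word, so the witness \<open>\<sigma>\<close> in the definition of the simsun property exists and is
  unique, and only the condition on double descents remains.
\<close>

lemma signed_simsun_iff:
  assumes "\<pi> \<in> signed_perms n"
  shows "\<pi> \<in> signed_simsun n \<longleftrightarrow> map \<pi> [1..int n] \<in> simsun_words n"
proof -
  let ?v = "map \<pi> [1..int n]"
  note w = signed_perms_word[OF assms]
  have "(\<exists>\<sigma>\<in>signed_perms (n - k). sp_word (n - k) \<sigma> = remove_largest n k (sp_word n \<pi>) \<and>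
      (\<nexists>i. double_descent (n - k) \<sigma> i)) \<longleftrightarrow>
      no_double_des (0 # filter (\<lambda>a. \<bar>a\<bar> \<le> int (n - k)) ?v)" if k: "k \<le> n" for k
  proof -
    have "signed_word (n - k) (filter (\<lambda>a. \<bar>a\<bar> \<le> int (n - k)) ?v)"
      using signed_word_filter[OF w(2)] by simp
    then obtain \<sigma> where s: "\<sigma> \<in> signed_perms (n - k)"
        "filter (\<lambda>a. \<bar>a\<bar> \<le> int (n - k)) ?v = map \<sigma> [1..int (n - k)]"
      using bij_betw_signed_perms_words[of "n - k"] unfolding bij_betw_def by blast
    have r: "remove_largest n k (sp_word n \<pi>) = 0 # filter (\<lambda>a. \<bar>a\<bar> \<le> int (n - k)) ?v"
      using remove_largest_signed_word[OF w(2) k] w(1) by simp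
    show ?thesis unfolding r no_double_descent_iff
      using s signed_perms_word(1)[OF s(1)] by metis
  qed
  moreover have "(\<forall>k\<le>n. P (n - k)) \<longleftrightarrow> (\<forall>m\<le>n. P m)" for P :: "nat \<Rightarrow> bool"
    by (metis diff_diff_cancel diff_le_self)
  ultimately show ?thesis using assms w(2)
    unfolding signed_simsun_def simsun_words_def mem_Collect_eq by (simp del: of_nat_diff)
qed

lemma bij_betw_signed_simsun_words:
  "bij_betw (\<lambda>\<pi>. map \<pi> [1..int n]) (signed_simsun n) (simsun_words n)"
proof (rule bij_betw_subset[OF bij_betw_signed_perms_words])
  show "signed_simsun n \<subseteq> signed_perms n" by (auto simp: signed_simsun_def)
  then have "signed_simsun n = {\<pi> \<in> signed_perms n. map \<pi> [1..int n] \<in> simsun_words n}"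
    using signed_simsun_iff by blast
  moreover have "simsun_words n \<subseteq> (\<lambda>\<pi>. map \<pi> [1..int n]) ` signed_perms n"
    using bij_betw_signed_perms_words[of n] by (auto simp: bij_betw_def simsun_words_def)
  ultimately show "(\<lambda>\<pi>. map \<pi> [1..int n]) ` signed_simsun n = simsun_words n"
    by fast
qed

lemma set_insertions: "u \<in> set (insertions e v) \<longleftrightarrow> (\<exists>p q. v = p @ q \<and> u = p @ e # q)"
proof (induction v arbitrary: u)
  case (Cons b v)
  have "(\<exists>p q. b # v = p @ q \<and> u = p @ e # q) \<longleftrightarrow>
      u = e # b # v \<or> (\<exists>p q. v = p @ q \<and> u = b # p @ e # q)" (is "?L \<longleftrightarrow> ?R")
  proof
    assume ?L
    then obtain p q where "b # v = p @ q" "u = p @ e # q" by blast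
    then show ?R by (cases p) auto
  next
    assume ?R
    then show ?L
    proof (elim disjE exE conjE)
      assume "u = e # b # v"
      then have "b # v = [] @ b # v \<and> u = [] @ e # b # v" by simp
      then show ?L by blast
    next
      fix p q assume "v = p @ q" "u = b # p @ e # q"
      then have "b # v = (b # p) @ q \<and> u = (b # p) @ e # q" by simp
      then show ?L by blast
    qed
  qed
  moreover have "u \<in> set (insertions e (b # v)) \<longleftrightarrow>
      u = e # b # v \<or> (\<exists>u'. u' \<in> set (insertions e v) \<and> u = b # u')"
    by auto
  then have "u \<in> set (insertions e (b # v)) \<longleftrightarrow> ?R"
    unfolding Cons.IH by blast
  ultimately show ?case by simp
qed auto

lemma distinct_insertions: "e \<notin> set v \<Longrightarrow> distinct (insertions e v)"
  by (induction v) (auto simp: distinct_map)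

lemma filter_insertion:
  assumes "u \<in> set (insertions e v)" "\<not> P e" "\<forall>a\<in>set v. P a"
  shows "filter P u = v"
  using assms by (auto simp: set_insertions)

lemma signed_word_insertion:
  assumes "signed_word n v" "u \<in> set (insertions e v)" "\<bar>e\<bar> = int (Suc n)"
  shows "signed_word (Suc n) u"
proof -
  obtain p q where pq: "v = p @ q" "u = p @ e # q" using assms(2) by (auto simp: set_insertions)
  have "abs ` set u = insert \<bar>e\<bar> (abs ` set v)" by (auto simp: pq)
  also have "\<dots> = {1..int (Suc n)}" using assms by (auto simp: signed_word_def)
  finally show ?thesis using assms(1) pq by (simp add: signed_word_def)
qed

text \<open>
  The simsun condition for \<open>k \<ge> 1\<close> says that deleting \<open>\<plusminus>(n + 1)\<close> leaves a simsun word; for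
  \<open>k = 0\<close> it forbids double descents in the word itself.
\<close>

lemma simsun_words_Suc:
  "simsun_words (Suc n) = (\<Union>v\<in>simsun_words n.
     {u \<in> set (insertions (int (Suc n)) v) \<union> set (insertions (- int (Suc n)) v). no_double_des (0 # u)})"
  (is "_ = ?R")
proof (intro equalityI subsetI)
  fix u assume u: "u \<in> simsun_words (Suc n)"
  then have sw: "signed_word (Suc n) u" by (simp add: simsun_words_def)
  have full: "filter (\<lambda>a. \<bar>a\<bar> \<le> int (Suc n)) u = u"
    using sw by (auto simp: signed_word_def filter_id_conv)
  have "int (Suc n) \<in> abs ` set u" using sw by (auto simp: signed_word_def)
  then obtain e where e: "e \<in> set u" "\<bar>e\<bar> = int (Suc n)" by auto
  then obtain p q where pq: "u = p @ e # q" by (meson split_list)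
  have "\<bar>a\<bar> \<le> int n" if a: "a \<in> set (p @ q)" for a
  proof -
    have "\<bar>e\<bar> \<notin> abs ` set (p @ q)" using signed_word_distinct_abs[OF sw] by (simp add: pq image_Un)
    then have "\<bar>a\<bar> \<noteq> \<bar>e\<bar>" using a by (metis image_eqI)
    moreover have "\<bar>a\<bar> \<in> abs ` set u" using a by (auto simp: pq)
    then have "\<bar>a\<bar> \<in> {1..int (Suc n)}" using sw unfolding signed_word_def by metis
    ultimately show ?thesis using e(2) by auto
  qed
  then have v: "filter (\<lambda>a. \<bar>a\<bar> \<le> int n) u = p @ q"
    using e(2) by (simp add: pq filter_id_conv)
  have "signed_word n (p @ q)"
    using signed_word_filter[OF sw, of n] v by simp
  moreover have "filter (\<lambda>a. \<bar>a\<bar> \<le> int m) (p @ q) = filter (\<lambda>a. \<bar>a\<bar> \<le> int m) u" if "m \<le> n" for m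
    using that e(2) by (simp add: pq)
  ultimately have "p @ q \<in> simsun_words n" using u by (simp add: simsun_words_def)
  moreover have "u \<in> set (insertions e (p @ q))" by (auto simp: set_insertions pq)
  moreover have "no_double_des (0 # u)" using u full by (auto simp: simsun_words_def)
  moreover have "e = int (Suc n) \<or> e = - int (Suc n)" using e(2) by linarith
  ultimately show "u \<in> ?R" by auto
next
  fix u assume "u \<in> ?R"
  then obtain v e where v: "v \<in> simsun_words n" "u \<in> set (insertions e v)" "\<bar>e\<bar> = int (Suc n)"
    and nd: "no_double_des (0 # u)" by fastforce
  then obtain p q where pq: "v = p @ q" "u = p @ e # q" by (auto simp: set_insertions)
  have sw: "signed_word (Suc n) u"
    using v signed_word_insertion by (auto simp: simsun_words_def)
  have "no_double_des (0 # filter (\<lambda>a. \<bar>a\<bar> \<le> int m) u)" if "m \<le> Suc n" for m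
  proof (cases "m = Suc n")
    case True
    have "filter (\<lambda>a. \<bar>a\<bar> \<le> int (Suc n)) u = u"
      using sw by (auto simp: signed_word_def filter_id_conv)
    then show ?thesis using nd True by simp
  next
    case False
    then have "filter (\<lambda>a. \<bar>a\<bar> \<le> int m) u = filter (\<lambda>a. \<bar>a\<bar> \<le> int m) v" using that v(3) by (simp add: pq)
    then show ?thesis using v(1) False that by (simp add: simsun_words_def)
  qed
  then show "u \<in> simsun_words (Suc n)" using sw by (simp add: simsun_words_def)
qed

lemma finite_simsun_words: "finite (simsun_words n)"
proof (rule finite_subset)
  show "simsun_words n \<subseteq> {v. set v \<subseteq> {- int n..int n} \<and> length v = n}"
  proof
    fix v assume "v \<in> simsun_words n"
    then have v: "length v = n" "abs ` set v = {1..int n}" by (auto simp: simsun_words_def signed_word_def)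
    have "a \<in> {- int n..int n}" if "a \<in> set v" for a
    proof -
      have "\<bar>a\<bar> \<in> {1..int n}" using that unfolding v(2)[symmetric] by (rule imageI)
      then show ?thesis by auto
    qed
    then show "v \<in> {v. set v \<subseteq> {- int n..int n} \<and> length v = n}" using v(1) by blast
  qed
qed (simp add: finite_lists_length_eq)

text \<open>
  The parent of a word is recovered by deleting its letter of largest absolute value; hence the
  sets of children are disjoint and each child is counted once.
\<close>

lemma sum_simsun_words_Suc:
  fixes f :: "int list \<Rightarrow> real"
  shows "(\<Sum>u\<in>simsun_words (Suc n). f u) =
    (\<Sum>v\<in>simsun_words n. children_sum (\<lambda>u. if no_double_des (0 # u) then f u else 0) (int (Suc n)) v)"
proof -
  let ?M = "int (Suc n)"
  define C where "C v = set (insertions ?M v) \<union> set (insertions (- ?M) v)" for v :: "int list"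
  define g where "g u = (if no_double_des (0 # u) then f u else 0)" for u
  have small: "\<forall>a\<in>set v. \<bar>a\<bar> \<le> int n" if "v \<in> simsun_words n" for v
    using that by (auto simp: simsun_words_def signed_word_def)
  have parent: "filter (\<lambda>a. \<bar>a\<bar> \<le> int n) u = v" if "v \<in> simsun_words n" "u \<in> C v" for u v
    using that small[OF that(1)] by (auto simp: C_def intro!: filter_insertion)
  have "children_sum g ?M v = (\<Sum>u\<in>C v. g u)" if v: "v \<in> simsun_words n" for v
  proof -
    have ni: "?M \<notin> set v" "- ?M \<notin> set v" using small[OF v] by auto
    have "?M \<in> set u" if "u \<in> set (insertions ?M v)" for u
      using that by (auto simp: set_insertions)
    moreover have "?M \<notin> set u" if "u \<in> set (insertions (- ?M) v)" for u
      using that ni by (auto simp: set_insertions)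
    ultimately have "set (insertions ?M v) \<inter> set (insertions (- ?M) v) = {}"
      by blast
    then show ?thesis using ni
      by (simp add: children_sum_def C_def sum.union_disjoint sum_list_distinct_conv_sum_set distinct_insertions)
  qed
  then have "(\<Sum>v\<in>simsun_words n. children_sum g ?M v) = (\<Sum>v\<in>simsun_words n. \<Sum>u\<in>C v. g u)"
    by simp
  also have "\<dots> = (\<Sum>u\<in>(\<Union>v\<in>simsun_words n. C v). g u)"
  proof (rule sum.UNION_disjoint[symmetric])
    show "\<forall>v\<in>simsun_words n. \<forall>w\<in>simsun_words n. v \<noteq> w \<longrightarrow> C v \<inter> C w = {}"
      using parent by blast
  qed (auto simp: C_def finite_simsun_words)
  also have "\<dots> = (\<Sum>u\<in>simsun_words (Suc n). f u)"
    unfolding simsun_words_Suc g_def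
    by (rule sum.mono_neutral_cong_right) (use finite_simsun_words in \<open>auto simp: C_def\<close>)
  finally show ?thesis unfolding g_def by simp
qed

section \<open>Recurrences for the descent polynomials\<close>

text \<open>
  Phrased with \<open>v \<noteq> [] \<and> hd v < 0\<close>, the sums also reproduce the conventions
  \<open>R_pos 0 = 1\<close> and \<open>R_neg 0 = 0\<close>.
\<close>

lemma R_pos_eq_sum_words:
  "R_pos n = (\<Sum>v\<in>simsun_words n. if v \<noteq> [] \<and> hd v < 0 then 0 else monom 1 (des (0 # v)))"
  and R_neg_eq_sum_words:
  "R_neg n = (\<Sum>v\<in>simsun_words n. if v \<noteq> [] \<and> hd v < 0 then monom 1 (des (0 # v)) else 0)"
proof -
  have "R_pos n = (\<Sum>v\<in>simsun_words n. if v \<noteq> [] \<and> hd v < 0 then 0 else monom 1 (des (0 # v))) \<and>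
     R_neg n = (\<Sum>v\<in>simsun_words n. if v \<noteq> [] \<and> hd v < 0 then monom 1 (des (0 # v)) else 0)"
  proof (cases "n = 0")
    case True
    have "simsun_words 0 = {[]}" by (auto simp: simsun_words_def signed_word_def)
    then show ?thesis using True by (simp add: R_pos_def R_neg_def)
  next
    case False
    let ?f = "\<lambda>\<pi>. map \<pi> [1..int n]"
    have fin: "finite (signed_simsun n)"
      using bij_betw_finite[OF bij_betw_signed_simsun_words] finite_simsun_words by blast
    have ne: "[1..int n] = 1 # [2..int n]" using False by (subst upto.simps) simp
    have des: "des_B n \<pi> = des (0 # ?f \<pi>)" if "\<pi> \<in> signed_simsun n" for \<pi>
    proof -
      have "\<pi> \<in> signed_perms n" using that by (simp add: signed_simsun_def)
      then show ?thesis by (simp add: des_B_eq signed_perms_word(1))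
    qed
    have sign: "\<pi> 1 \<noteq> 0" if "\<pi> \<in> signed_simsun n" for \<pi>
    proof -
      have "\<pi> permutes ({- int n..int n} - {0})"
        using that by (simp add: signed_simsun_def signed_perms_def)
      then have "\<pi> 1 \<in> {- int n..int n} - {0}"
        using False by (subst permutes_in_image) auto
      then show ?thesis by simp
    qed
    have "R_pos n = (\<Sum>\<pi>\<in>signed_simsun n. if 0 < \<pi> 1 then monom 1 (des_B n \<pi>) else 0)"
      unfolding R_pos_def signed_simsun_pos_def using False fin by (simp add: sum.inter_filter)
    also have "\<dots> = (\<Sum>\<pi>\<in>signed_simsun n. if \<pi> 1 < 0 then 0 else monom 1 (des_B n \<pi>))"
    proof (rule sum.cong)
      fix \<pi> assume "\<pi> \<in> signed_simsun n"
      then have "\<pi> 1 < 0 \<longleftrightarrow> \<not> 0 < \<pi> 1" using sign by force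
      then show "(if 0 < \<pi> 1 then monom 1 (des_B n \<pi>) else 0) = (if \<pi> 1 < 0 then 0 else monom (1::real) (des_B n \<pi>))"
        by simp
    qed simp
    also have "\<dots> = (\<Sum>\<pi>\<in>signed_simsun n. if ?f \<pi> \<noteq> [] \<and> hd (?f \<pi>) < 0 then 0 else monom 1 (des (0 # ?f \<pi>)))"
      by (rule sum.cong) (auto simp: ne des)
    also have "\<dots> = (\<Sum>v\<in>simsun_words n. if v \<noteq> [] \<and> hd v < 0 then 0 else monom 1 (des (0 # v)))"
      by (rule sum.reindex_bij_betw[OF bij_betw_signed_simsun_words])
    finally have pos: "R_pos n = (\<Sum>v\<in>simsun_words n. if v \<noteq> [] \<and> hd v < 0 then 0 else monom 1 (des (0 # v)))" .
    have "R_neg n = (\<Sum>\<pi>\<in>signed_simsun n. if \<pi> 1 < 0 then monom 1 (des_B n \<pi>) else 0)"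
      unfolding R_neg_def signed_simsun_neg_def using False fin by (simp add: sum.inter_filter)
    also have "\<dots> = (\<Sum>\<pi>\<in>signed_simsun n. if ?f \<pi> \<noteq> [] \<and> hd (?f \<pi>) < 0 then monom 1 (des (0 # ?f \<pi>)) else 0)"
      by (rule sum.cong) (auto simp: ne des)
    also have "\<dots> = (\<Sum>v\<in>simsun_words n. if v \<noteq> [] \<and> hd v < 0 then monom 1 (des (0 # v)) else 0)"
      by (rule sum.reindex_bij_betw[OF bij_betw_signed_simsun_words])
    finally show ?thesis using pos by blast
  qed
  then show "R_pos n = (\<Sum>v\<in>simsun_words n. if v \<noteq> [] \<and> hd v < 0 then 0 else monom 1 (des (0 # v)))"
    and "R_neg n = (\<Sum>v\<in>simsun_words n. if v \<noteq> [] \<and> hd v < 0 then monom 1 (des (0 # v)) else 0)"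
    by blast+
qed

lemma simsun_words_facts:
  assumes "v \<in> simsun_words n"
  shows "length v = n" and "\<forall>b\<in>set v. \<bar>b\<bar> < int (Suc n)" and "0 \<notin> set v" and "no_double_des (0 # v)"
proof -
  have sw: "signed_word n v" using assms by (simp add: simsun_words_def)
  then have *: "\<bar>b\<bar> \<in> {1..int n}" if "b \<in> set v" for b using that by (auto simp: signed_word_def)
  show "length v = n" using sw by (simp add: signed_word_def)
  show "\<forall>b\<in>set v. \<bar>b\<bar> < int (Suc n)" using * by fastforce
  show "0 \<notin> set v" using *[of 0] by auto
  have "filter (\<lambda>a. \<bar>a\<bar> \<le> int n) v = v" using * by (auto simp: filter_id_conv)
  moreover have "no_double_des (0 # filter (\<lambda>a. \<bar>a\<bar> \<le> int n) v)"
    using assms by (simp add: simsun_words_def)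
  ultimately show "no_double_des (0 # v)" by simp
qed

lemma poly_R_pos: "poly (R_pos n) y = (\<Sum>v\<in>simsun_words n. if v \<noteq> [] \<and> hd v < 0 then 0 else y ^ des (0 # v))"
  unfolding R_pos_eq_sum_words poly_sum by (rule sum.cong) (auto simp: poly_monom)

lemma poly_R_neg: "poly (R_neg n) y = (\<Sum>v\<in>simsun_words n. if v \<noteq> [] \<and> hd v < 0 then y ^ des (0 # v) else 0)"
  unfolding R_neg_eq_sum_words poly_sum by (rule sum.cong) (auto simp: poly_monom)

lemma pderiv_sum: "pderiv (\<Sum>a\<in>A. f a) = (\<Sum>a\<in>A. pderiv (f a))"
  by (induction A rule: infinite_finite_induct) (simp_all add: pderiv_add)

text \<open>
  The factor \<open>des\<close> in the numbers of children is produced by \<open>y d/dy\<close>.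
\<close>

lemma mult_poly_pderiv_monom: "y * poly (pderiv (monom 1 d)) y = real d * (y :: real) ^ d"
  by (cases d) (simp_all add: pderiv_monom poly_monom)

lemma mult_poly_pderiv_R_pos: "y * poly (pderiv (R_pos n)) y =
    (\<Sum>v\<in>simsun_words n. if v \<noteq> [] \<and> hd v < 0 then 0 else real (des (0 # v)) * y ^ des (0 # v))"
  unfolding R_pos_eq_sum_words pderiv_sum poly_sum sum_distrib_left
  by (rule sum.cong) (auto simp: mult_poly_pderiv_monom)

lemma mult_poly_pderiv_R_neg: "y * poly (pderiv (R_neg n)) y =
    (\<Sum>v\<in>simsun_words n. if v \<noteq> [] \<and> hd v < 0 then real (des (0 # v)) * y ^ des (0 # v) else 0)"
  unfolding R_neg_eq_sum_words pderiv_sum poly_sum sum_distrib_left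
  by (rule sum.cong) (auto simp: mult_poly_pderiv_monom)

lemma R_pos_Suc:
  "poly (R_pos (Suc n)) y = poly (R_pos n) y + 2 * y * (1 - 2 * y) * poly (pderiv (R_pos n)) y +
     2 * real n * y * poly (R_pos n) y + poly (R_neg n) y"
proof -
  let ?g = "\<lambda>u. if 0 < hd u then weight y (0 # u) else 0"
  have "poly (R_pos (Suc n)) y = (\<Sum>u\<in>simsun_words (Suc n). if 0 < hd u then y ^ des (0 # u) else 0)"
    unfolding poly_R_pos
  proof (rule sum.cong)
    fix u assume "u \<in> simsun_words (Suc n)"
    note facts = simsun_words_facts[OF this]
    have "u \<noteq> []" using facts(1) by auto
    moreover have "hd u \<noteq> 0" using facts(3) hd_in_set[OF \<open>u \<noteq> []\<close>] by metis
    ultimately show "(if u \<noteq> [] \<and> hd u < 0 then 0 else y ^ des (0 # u)) = (if 0 < hd u then y ^ des (0 # u) else 0)"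
      by auto
  qed simp
  also have "\<dots> = (\<Sum>v\<in>simsun_words n. children_sum ?g (int (Suc n)) v)"
    unfolding sum_simsun_words_Suc
    by (intro sum.cong arg_cong[where f = "\<lambda>g. children_sum g _ _"]) (auto simp: weight_def)
  also have "\<dots> = (\<Sum>v\<in>simsun_words n.
      (1 + 2 * real n * y) * (if v \<noteq> [] \<and> hd v < 0 then 0 else y ^ des (0 # v)) +
      2 * (1 - 2 * y) * (if v \<noteq> [] \<and> hd v < 0 then 0 else real (des (0 # v)) * y ^ des (0 # v)) +
      (if v \<noteq> [] \<and> hd v < 0 then y ^ des (0 # v) else 0))"
  proof (rule sum.cong)
    fix v assume v: "v \<in> simsun_words n"
    note facts = simsun_words_facts[OF v]
    have hd: "v \<noteq> [] \<Longrightarrow> hd v \<noteq> 0" using facts(3) hd_in_set by metis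
    show "children_sum ?g (int (Suc n)) v =
      (1 + 2 * real n * y) * (if v \<noteq> [] \<and> hd v < 0 then 0 else y ^ des (0 # v)) +
      2 * (1 - 2 * y) * (if v \<noteq> [] \<and> hd v < 0 then 0 else real (des (0 # v)) * y ^ des (0 # v)) +
      (if v \<noteq> [] \<and> hd v < 0 then y ^ des (0 # v) else 0)"
    proof (cases "v \<noteq> [] \<and> hd v < 0")
      case True
      then show ?thesis using children_sum_neg_first(1)[OF facts(2) _ facts(4)] by simp
    next
      case False
      then have "v \<noteq> [] \<Longrightarrow> 0 < hd v" using hd by force
      then have "children_sum ?g (int (Suc n)) v = (1 + 2 * real (des (0 # v))) * y ^ des (0 # v) +
          2 * (real n - 2 * real (des (0 # v))) * y ^ Suc (des (0 # v))"
        using children_sum_pos_first(1)[OF facts(2) _ facts(4)] facts(1) by simp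
      then show ?thesis unfolding if_not_P[OF False] by (simp add: algebra_simps)
    qed
  qed simp
  also have "\<dots> = (1 + 2 * real n * y) * poly (R_pos n) y +
      2 * (1 - 2 * y) * (y * poly (pderiv (R_pos n)) y) + poly (R_neg n) y"
    unfolding mult_poly_pderiv_R_pos unfolding poly_R_pos poly_R_neg sum_distrib_left sum.distrib ..
  finally show ?thesis by (simp add: algebra_simps)
qed

lemma R_neg_Suc:
  "poly (R_neg (Suc n)) y = y * poly (R_pos n) y + 2 * y * (1 - 2 * y) * poly (pderiv (R_neg n)) y +
     2 * (real n + 1) * y * poly (R_neg n) y"
proof -
  let ?g = "\<lambda>u. if hd u < 0 then weight y (0 # u) else 0"
  have "poly (R_neg (Suc n)) y = (\<Sum>u\<in>simsun_words (Suc n). if hd u < 0 then y ^ des (0 # u) else 0)"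
    unfolding poly_R_neg
  proof (rule sum.cong)
    fix u assume "u \<in> simsun_words (Suc n)"
    from simsun_words_facts[OF this] have "u \<noteq> []" by auto
    then show "(if u \<noteq> [] \<and> hd u < 0 then y ^ des (0 # u) else 0) = (if hd u < 0 then y ^ des (0 # u) else 0)"
      by auto
  qed simp
  also have "\<dots> = (\<Sum>v\<in>simsun_words n. children_sum ?g (int (Suc n)) v)"
    unfolding sum_simsun_words_Suc
    by (intro sum.cong arg_cong[where f = "\<lambda>g. children_sum g _ _"]) (auto simp: weight_def)
  also have "\<dots> = (\<Sum>v\<in>simsun_words n.
      y * (if v \<noteq> [] \<and> hd v < 0 then 0 else y ^ des (0 # v)) +
      2 * (1 - 2 * y) * (if v \<noteq> [] \<and> hd v < 0 then real (des (0 # v)) * y ^ des (0 # v) else 0) +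
      2 * (real n + 1) * y * (if v \<noteq> [] \<and> hd v < 0 then y ^ des (0 # v) else 0))"
  proof (rule sum.cong)
    fix v assume v: "v \<in> simsun_words n"
    note facts = simsun_words_facts[OF v]
    have hd: "v \<noteq> [] \<Longrightarrow> hd v \<noteq> 0" using facts(3) hd_in_set by metis
    show "children_sum ?g (int (Suc n)) v =
      y * (if v \<noteq> [] \<and> hd v < 0 then 0 else y ^ des (0 # v)) +
      2 * (1 - 2 * y) * (if v \<noteq> [] \<and> hd v < 0 then real (des (0 # v)) * y ^ des (0 # v) else 0) +
      2 * (real n + 1) * y * (if v \<noteq> [] \<and> hd v < 0 then y ^ des (0 # v) else 0)"
    proof (cases "v \<noteq> [] \<and> hd v < 0")
      case True
      then show ?thesis using children_sum_neg_first(2)[OF facts(2) _ facts(4)]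
        by (simp add: facts(1) algebra_simps)
    next
      case False
      then have "v \<noteq> [] \<Longrightarrow> 0 < hd v" using hd by force
      then have "children_sum ?g (int (Suc n)) v = y ^ Suc (des (0 # v))"
        using children_sum_pos_first(2)[OF facts(2) _ facts(4)] by simp
      then show ?thesis unfolding if_not_P[OF False] by simp
    qed
  qed simp
  also have "\<dots> = y * poly (R_pos n) y +
      2 * (1 - 2 * y) * (y * poly (pderiv (R_neg n)) y) + 2 * (real n + 1) * y * poly (R_neg n) y"
    unfolding mult_poly_pderiv_R_neg unfolding poly_R_pos poly_R_neg sum_distrib_left sum.distrib ..
  finally show ?thesis by (simp add: algebra_simps)
qed

section \<open>Taylor terms of the closed forms\<close>

text \<open>
  The bridge from the complex to the real line: coefficientwise real parts do not shrink the disc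
  of convergence, so real functions with a holomorphic extension inherit its Taylor expansion.
\<close>

lemma has_fps_expansion_Re:
  fixes g :: "complex \<Rightarrow> complex"
  assumes "g has_fps_expansion C"
  shows "(\<lambda>t::real. Re (g (of_real t))) has_fps_expansion Abs_fps (\<lambda>n. Re (fps_nth C n))" (is "_ has_fps_expansion ?F")
proof -
  have pos: "0 < fps_conv_radius C" and ev: "eventually (\<lambda>z. eval_fps C z = g z) (nhds 0)"
    using assms by (auto simp: has_fps_expansion_def)
  have sums: "(\<lambda>n. fps_nth ?F n * t ^ n) sums Re (eval_fps C (of_real t))"
    if "ereal (norm t) < fps_conv_radius C" for t :: real
  proof -
    have "(\<lambda>n. fps_nth C n * of_real t ^ n) sums eval_fps C (of_real t)"
      using that by (intro sums_eval_fps) simp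
    then have "(\<lambda>n. Re (fps_nth C n * of_real t ^ n)) sums Re (eval_fps C (of_real t))"
      by (rule sums_Re)
    moreover have "Re (fps_nth C n * of_real t ^ n) = fps_nth ?F n * t ^ n" for n
      by (simp flip: of_real_power)
    ultimately show ?thesis by simp
  qed
  obtain r where r: "0 < ereal r" "ereal r < fps_conv_radius C"
    using ereal_dense2[OF pos] by auto
  have "summable (\<lambda>n. fps_nth ?F n * r ^ n)"
    using sums[of r] r by (auto simp: sums_iff)
  then have "ereal (norm r) \<le> fps_conv_radius ?F"
    unfolding fps_conv_radius_def by (rule conv_radius_geI)
  then have "ereal r \<le> fps_conv_radius ?F" using r(1) by simp
  with r(1) have "0 < fps_conv_radius ?F" by (rule less_le_trans)
  moreover have "eventually (\<lambda>t. eval_fps ?F t = Re (g (of_real t))) (nhds 0)"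
  proof -
    have "filterlim (of_real :: real \<Rightarrow> complex) (nhds (of_real 0)) (nhds 0)"
      by (intro tendsto_intros filterlim_ident)
    then have "eventually (\<lambda>t::real. eval_fps C (of_real t) = g (of_real t)) (nhds 0)"
      using ev by (auto simp: filterlim_iff)
    moreover have "eventually (\<lambda>t::real. t \<in> eball 0 (fps_conv_radius C)) (nhds 0)"
      using pos by (intro eventually_nhds_in_open) (auto simp: zero_ereal_def)
    ultimately show ?thesis
    proof eventually_elim
      case (elim t)
      then have "ereal (norm t) < fps_conv_radius C" by (simp add: in_eball_iff)
      from sums_unique[OF sums[OF this]] elim show ?case by (simp add: eval_fps_def)
    qed
  qed
  ultimately show ?thesis by (simp add: has_fps_expansion_def)
qed

text \<open>
  For \<open>G\<close> real on the real axis these are the iterated real derivatives of its restriction.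
\<close>

definition real_higher_deriv :: "(complex \<Rightarrow> complex) \<Rightarrow> nat \<Rightarrow> real \<Rightarrow> real" where
  "real_higher_deriv G n y = Re ((deriv ^^ n) G (of_real y))"

lemma has_real_derivative_real_higher_deriv:
  assumes "G analytic_on {of_real y}"
  shows "(real_higher_deriv G n has_real_derivative real_higher_deriv G (Suc n) y) (at y)"
proof -
  have "(deriv ^^ n) G analytic_on {of_real y}" using assms by (rule analytic_higher_deriv)
  then have "(deriv ^^ n) G field_differentiable at (of_real y)"
    using analytic_on_imp_differentiable_at by blast
  then have "((deriv ^^ n) G has_field_derivative (deriv ^^ Suc n) G (of_real y)) (at (of_real y))"
    by (simp add: DERIV_deriv_iff_field_differentiable)
  then have "((\<lambda>t. (deriv ^^ n) G (of_real t)) has_vector_derivative (deriv ^^ Suc n) G (of_real y)) (at y)"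
    by (rule has_vector_derivative_real_field)
  from has_field_derivative_Re[OF this] show ?thesis
    unfolding real_higher_deriv_def .
qed

lemma has_fps_expansion_real_higher_deriv:
  assumes "G analytic_on {of_real y}"
  shows "(\<lambda>t. real_higher_deriv G 0 (y + s * t)) has_fps_expansion
    Abs_fps (\<lambda>n. s ^ n * real_higher_deriv G n y / fact n)"
proof -
  have "((\<lambda>z. G (of_real y + z)) \<circ> (\<lambda>t. of_real s * t)) has_fps_expansion
      fps_compose (fps_expansion G (of_real y)) (fps_const (of_real s) * fps_X)"
    using assms by (intro has_fps_expansion_compose analytic_at_imp_has_fps_expansion fps_expansion_intros) simp_all
  note expansion = has_fps_expansion_Re[OF this]
  have coeff: "Re (of_real s ^ n * ((deriv ^^ n) G (of_real y) / fact n)) = s ^ n * real_higher_deriv G n y / fact n" for n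
  proof -
    have "of_real s ^ n * ((deriv ^^ n) G (of_real y) / fact n) = of_real (s ^ n / fact n) * (deriv ^^ n) G (of_real y)"
      by simp
    also have "Re \<dots> = s ^ n / fact n * Re ((deriv ^^ n) G (of_real y))"
      by (simp only: times_complex.sel Re_complex_of_real Im_complex_of_real)
    finally show ?thesis by (simp add: real_higher_deriv_def)
  qed
  show ?thesis
    using expansion
    by (simp only: fps_compose_linear fps_expansion_def fps_nth_Abs_fps coeff o_def
      real_higher_deriv_def funpow_0 of_real_add of_real_mult)
qed

text \<open>
  The common holomorphic extension of \<open>F1\<close> and \<open>F2\<close>, with exponent \<open>a = \<plusminus> 1 / sqrt 2\<close>. It is used
  near the interval from \<open>- pi\<close> to \<open>0\<close> only, where the base of the power is positive and so avoids the
  branch cut.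
\<close>

definition F_complex :: "real \<Rightarrow> complex \<Rightarrow> complex" where
  "F_complex a z = - 1 / (of_real (sqrt 2) * sin z) * (- sin z / (1 + cos z)) powr of_real a"

lemma
  assumes "- pi < y" "y < 0"
  shows F_complex_analytic: "F_complex a analytic_on {of_real y}"
    and F_complex_of_real: "real_higher_deriv (F_complex a) 0 y =
      - 1 / (sqrt 2 * sin y) * (- sin y / (1 + cos y)) powr a"
proof -
  have sin: "sin y < 0" using sin_gt_zero[of "- y"] assms by simp
  have "cos (- y) > cos pi" using assms by (intro cos_monotone_0_pi) auto
  then have cos: "1 + cos y > 0" by simp
  have pos: "- sin y / (1 + cos y) > 0" using sin cos by (intro divide_pos_pos) auto
  have eq: "- sin (of_real y) / (1 + cos (of_real y) :: complex) = of_real (- sin y / (1 + cos y))"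
    by (simp add: sin_of_real cos_of_real)
  have "1 + cos (of_real y :: complex) = of_real (1 + cos y)" by (simp add: cos_of_real)
  then have nz: "1 + cos (of_real y :: complex) \<noteq> 0" using cos by (metis less_irrefl of_real_eq_0_iff)
  have "sin (of_real y :: complex) \<noteq> 0" using sin by (simp add: sin_of_real)
  moreover have "- sin (of_real y) / (1 + cos (of_real y) :: complex) \<notin> \<real>\<^sub>\<le>\<^sub>0"
    unfolding eq using pos by (simp only: nonpos_Reals_of_real_iff)
  ultimately show "F_complex a analytic_on {of_real y}"
    unfolding F_complex_def using nz by (intro analytic_intros) auto
  have "F_complex a (of_real y) = of_real (- 1 / (sqrt 2 * sin y) * (- sin y / (1 + cos y)) powr a)"
    unfolding F_complex_def eq using pos by (subst powr_of_real) (simp_all add: sin_of_real)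
  then show "real_higher_deriv (F_complex a) 0 y =
      - 1 / (sqrt 2 * sin y) * (- sin y / (1 + cos y)) powr a"
    by (simp only: real_higher_deriv_def funpow_0 Re_complex_of_real)
qed

text \<open>
  Half the \<open>n\<close>-th derivative at \<open>t = 0\<close> of \<open>s * P x * G (u_fun x t)\<close>, where
  \<open>s = sqrt (2 * x - 1)\<close>. The theorem needs the cases \<open>P = p_fun\<close> and \<open>P = 1 / p_fun\<close>.
\<close>

definition taylor_term :: "(real \<Rightarrow> real) \<Rightarrow> (complex \<Rightarrow> complex) \<Rightarrow> nat \<Rightarrow> real \<Rightarrow> real" where
  "taylor_term P G n x = sqrt (2 * x - 1) ^ Suc n * P x / 2 * real_higher_deriv G n (- arctan (sqrt (2 * x - 1)))"

text \<open>
  The three summands come from differentiating the power of \<open>s\<close>, the factor \<open>P\<close> and the angle.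
  After multiplication by \<open>2 * x * (1 - 2 * x) = - 2 * x * s\<^sup>2\<close> the derivative of the angle,
  \<open>- 1 / (2 * x * s)\<close>, becomes \<open>s\<close>, which turns the last summand into the next Taylor term.
\<close>

lemma taylor_term_derivative:
  assumes x: "x > 1 / 2"
    and P: "(P has_real_derivative e * P x / (2 * sqrt x * (1 - 2 * x))) (at x)"
    and G: "G analytic_on {of_real (- arctan (sqrt (2 * x - 1)))}"
  obtains D where "(taylor_term P G n has_real_derivative D) (at x)"
    and "2 * x * (1 - 2 * x) * D = taylor_term P G (Suc n) x - (2 * x * (real n + 1) - e * sqrt x) * taylor_term P G n x"
proof -
  define s where "s = sqrt (2 * x - 1)"
  have s: "s > 0" "s\<^sup>2 = 2 * x - 1" using x by (auto simp: s_def)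
  define q where "q = sqrt x"
  have q: "q > 0" "q\<^sup>2 = x" using x by (auto simp: q_def)
  define H where "H = real_higher_deriv G n (- arctan s)"
  define H' where "H' = real_higher_deriv G (Suc n) (- arctan s)"
  have ds: "((\<lambda>x. sqrt (2 * x - 1)) has_real_derivative 1 / s) (at x)"
    unfolding s_def using x by (auto intro!: derivative_eq_intros simp: divide_simps)
  have "((\<lambda>x. - arctan (sqrt (2 * x - 1))) has_real_derivative - (1 / s * inverse (1 + s\<^sup>2))) (at x)"
    using DERIV_minus[OF DERIV_chain2[OF DERIV_arctan ds]] by (simp add: s_def mult.commute)
  then have dth: "((\<lambda>x. - arctan (sqrt (2 * x - 1))) has_real_derivative - 1 / (2 * x * s)) (at x)"
    using s by (simp add: field_simps)
  have dH: "((\<lambda>x. real_higher_deriv G n (- arctan (sqrt (2 * x - 1)))) has_real_derivative H' * (- 1 / (2 * x * s))) (at x)"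
    unfolding H'_def s_def
    by (rule DERIV_chain2[OF has_real_derivative_real_higher_deriv dth[unfolded s_def]]) (rule G)
  have dpow: "((\<lambda>x. sqrt (2 * x - 1) ^ Suc n) has_real_derivative real (Suc n) * (s ^ n * (1 / s))) (at x)"
    using DERIV_power[OF ds, of "Suc n"] by (simp add: s_def mult_ac)
  define D where "D = (real (Suc n) * (s ^ n * (1 / s)) * P x + e * P x / (2 * q * (1 - 2 * x)) * s ^ Suc n) / 2 * H
      + H' * (- 1 / (2 * x * s)) * (s ^ Suc n * P x / 2)"
  have "(taylor_term P G n has_real_derivative D) (at x)"
    unfolding taylor_term_def[abs_def]
    using DERIV_mult[OF DERIV_cdivide[OF DERIV_mult[OF dpow P], of 2] dH]
    by (simp only: D_def H_def q_def s_def)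
  moreover have "2 * x * (1 - 2 * x) * D = s ^ Suc (Suc n) * P x / 2 * H' - (2 * x * (real n + 1) - e * q) * (s ^ Suc n * P x / 2 * H)"
  proof -
    have sx: "1 - 2 * x = - (s * s)" using s(2) by (simp add: power2_eq_square)
    have "2 * x * (1 - 2 * x) * (real (Suc n) * (s ^ n * (1 / s)) * P x / 2 * H) =
        - (2 * x * (real n + 1)) * (s ^ Suc n * P x / 2 * H)"
      unfolding sx using s(1) by (simp add: field_simps)
    moreover have "2 * x * (1 - 2 * x) * (e * P x / (2 * q * (1 - 2 * x)) * s ^ Suc n / 2 * H) =
        e * q * (s ^ Suc n * P x / 2 * H)"
    proof -
      have "2 * x * (1 - 2 * x) * (e * P x / (2 * q * (1 - 2 * x)) * s ^ Suc n / 2 * H) =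
         (x / q) * (e * (s ^ Suc n * P x / 2 * H))"
        using x q(1) by (simp add: field_simps)
      also have "x / q = q" using q by (simp add: power2_eq_square field_simps)
      finally show ?thesis by simp
    qed
    moreover have "2 * x * (1 - 2 * x) * (H' * (- 1 / (2 * x * s)) * (s ^ Suc n * P x / 2)) =
        s ^ Suc (Suc n) * P x / 2 * H'"
      unfolding sx using s(1) x by (simp add: field_simps)
    moreover have "2 * x * (1 - 2 * x) * D =
        2 * x * (1 - 2 * x) * (real (Suc n) * (s ^ n * (1 / s)) * P x / 2 * H) +
        2 * x * (1 - 2 * x) * (e * P x / (2 * q * (1 - 2 * x)) * s ^ Suc n / 2 * H) +
        2 * x * (1 - 2 * x) * (H' * (- 1 / (2 * x * s)) * (s ^ Suc n * P x / 2))"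
      unfolding D_def by (simp only: ring_distribs add_divide_distrib)
    moreover have "- a * k + b * k + l = l - (a - b) * k" for a b k l :: real
      by (simp add: algebra_simps)
    ultimately show ?thesis by metis
  qed
  ultimately show ?thesis
    by (intro that) (simp_all only: taylor_term_def H_def H'_def s_def q_def)
qed

lemma sqrt_gt_one: "x > 1 / 2 \<Longrightarrow> sqrt (2 * x) > 1"
  using real_less_rsqrt[of 1 "2 * x"] by simp

lemma p_fun_pos:
  assumes "x > 1 / 2" shows "p_fun x > 0"
proof -
  have "(sqrt (2 * x) + 1) / (sqrt (2 * x) - 1) > 0"
    using sqrt_gt_one[OF assms] by (intro divide_pos_pos) linarith+
  then show ?thesis unfolding p_fun_def powr_gt_zero by (rule dual_order.strict_implies_not_eq)
qed

lemma p_fun_derivative: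
  assumes x: "x > 1 / 2"
  shows "(p_fun has_real_derivative p_fun x / (2 * sqrt x * (1 - 2 * x))) (at x)"
proof -
  define r where "r = sqrt (2 * x)"
  have r: "r > 1" "r\<^sup>2 = 2 * x" "r = sqrt 2 * sqrt x"
    using x sqrt_gt_one[OF x] by (simp_all add: r_def) (simp add: real_sqrt_mult)
  \<comment> \<open>logarithmic form of \<open>p_fun\<close>\<close>
  define f where "f y = exp (sqrt 2 / 4 * (ln (sqrt (2 * y) + 1) - ln (sqrt (2 * y) - 1)))" for y
  have f_eq: "f y = p_fun y" if "y \<in> {1/2<..}" for y
  proof -
    have "sqrt (2 * y) > 1" using that sqrt_gt_one by auto
    then have "sqrt (2 * y) + 1 \<noteq> 0" "sqrt (2 * y) - 1 \<noteq> 0" by linarith+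
    then show ?thesis by (simp add: f_def p_fun_def powr_def ln_div)
  qed
  have dr: "((\<lambda>y. sqrt (2 * y)) has_real_derivative 1 / r) (at x)"
    unfolding r_def using x by (auto intro!: derivative_eq_intros simp: divide_simps)
  have "(f has_real_derivative f x * (sqrt 2 / 4 * (1 / r * inverse (r + 1) - 1 / r * inverse (r - 1)))) (at x)"
  proof -
    have "((\<lambda>y. ln (sqrt (2 * y) + 1)) has_real_derivative inverse (sqrt (2 * x) + 1) * (1 / r + 0)) (at x)"
      using sqrt_gt_one[OF x] by (intro DERIV_chain2[OF DERIV_ln] DERIV_add dr DERIV_const) linarith
    moreover have "((\<lambda>y. ln (sqrt (2 * y) - 1)) has_real_derivative inverse (sqrt (2 * x) - 1) * (1 / r - 0)) (at x)"
      using sqrt_gt_one[OF x] by (intro DERIV_chain2[OF DERIV_ln] DERIV_diff dr DERIV_const) linarith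
    ultimately have "(f has_real_derivative f x * (sqrt 2 / 4 *
        (inverse (sqrt (2 * x) + 1) * (1 / r + 0) - inverse (sqrt (2 * x) - 1) * (1 / r - 0)))) (at x)"
      unfolding f_def[abs_def] by (intro DERIV_chain2[OF DERIV_exp] DERIV_cmult DERIV_diff)
    then show ?thesis by (simp only: r_def add_0_right diff_0_right mult.commute)
  qed
  also have "sqrt 2 / 4 * (1 / r * inverse (r + 1) - 1 / r * inverse (r - 1)) =
      1 / (2 * sqrt x * (1 - 2 * x))"
  proof -
    have "1 / r * inverse (r + 1) - 1 / r * inverse (r - 1) = 2 / (r * (1 - r\<^sup>2))"
    proof -
      have nz: "r + 1 \<noteq> 0" "r - 1 \<noteq> 0" "r \<noteq> 0" using r(1) by linarith+
      have "inverse (r + 1) - inverse (r - 1) = - 2 / ((r + 1) * (r - 1))"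
        using nz by (simp add: divide_simps)
      also have "\<dots> = 2 / (1 - r\<^sup>2)"
      proof -
        have "(r + 1) * (r - 1) = - (1 - r\<^sup>2)" by (simp add: power2_eq_square algebra_simps)
        then show ?thesis by (simp only: minus_divide_divide)
      qed
      finally have "1 / r * (inverse (r + 1) - inverse (r - 1)) = 1 / r * (2 / (1 - r\<^sup>2))" by simp
      then show ?thesis by (simp only: right_diff_distrib[symmetric] times_divide_times_eq mult_1)
    qed
    also have "sqrt 2 / 4 * \<dots> = sqrt 2 / (2 * r * (1 - 2 * x))" unfolding r(2) by simp
    also have "\<dots> = 1 / (2 * sqrt x * (1 - 2 * x))" unfolding r(3) by simp
    finally show ?thesis .
  qed
  finally have "(f has_real_derivative p_fun x / (2 * sqrt x * (1 - 2 * x))) (at x)"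
    using f_eq x by simp
  then show ?thesis
    by (rule has_field_derivative_transform_within_open[where S = "{1/2<..}"]) (use x f_eq in auto)
qed

lemma inverse_p_fun_derivative:
  assumes x: "x > 1 / 2"
  shows "((\<lambda>x. inverse (p_fun x)) has_real_derivative (- 1) * inverse (p_fun x) / (2 * sqrt x * (1 - 2 * x))) (at x)"
  using DERIV_inverse_fun[OF p_fun_derivative[OF x]] p_fun_pos[OF x] by (simp add: field_simps)

text \<open>
  With \<open>w = - sin y / (1 + cos y) = tan (arctan s / 2)\<close> and \<open>r = sqrt (2 * x)\<close> one has
  \<open>w = s / (r + 1)\<close>, and \<open>s\<^sup>2 = r\<^sup>2 - 1\<close> gives \<open>w\<^sup>2 = (r - 1) / (r + 1)\<close>, the reciprocal of the base
  of the power in \<open>p_fun\<close>.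
\<close>

lemma half_angle_value:
  assumes x: "x > 1 / 2"
  defines "y \<equiv> - arctan (sqrt (2 * x - 1))"
  shows "sqrt (2 * x - 1) * (- 1 / (sqrt 2 * sin y)) = sqrt x"
    and "(- sin y / (1 + cos y)) powr (1 / sqrt 2) = inverse (p_fun x)"
    and "(- sin y / (1 + cos y)) powr (- (1 / sqrt 2)) = p_fun x"
proof -
  define s where "s = sqrt (2 * x - 1)"
  define r where "r = sqrt (2 * x)"
  have s: "s > 0" "s\<^sup>2 = 2 * x - 1" using x by (auto simp: s_def)
  have r: "r > 1" "r\<^sup>2 = 2 * x" "r = sqrt 2 * sqrt x"
    using x sqrt_gt_one[OF x] by (simp_all add: r_def) (simp add: real_sqrt_mult)
  have rs: "sqrt (1 + s\<^sup>2) = r" using s by (simp add: r_def)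
  have siny: "sin y = - s / r" using rs by (simp add: y_def sin_arctan flip: s_def)
  have cosy: "cos y = 1 / r" using rs by (simp add: y_def cos_arctan flip: s_def)
  show "sqrt (2 * x - 1) * (- 1 / (sqrt 2 * sin y)) = sqrt x"
    unfolding siny s_def[symmetric] using s(1) r(1,3) by (simp add: field_simps)
  define w where "w = - sin y / (1 + cos y)"
  have w: "w = s / (r + 1)" unfolding w_def siny cosy using r(1) by (simp add: field_simps)
  have w_pos: "w > 0" unfolding w using s(1) r(1) by simp
  have "w\<^sup>2 = (r\<^sup>2 - 1) / (r + 1)\<^sup>2" unfolding w power_divide s(2) r(2) ..
  also have "r\<^sup>2 - 1 = (r + 1) * (r - 1)" by (simp add: power2_eq_square algebra_simps)
  also have "(r + 1) * (r - 1) / (r + 1)\<^sup>2 = inverse ((r + 1) / (r - 1))"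
    using r(1) by (simp add: power2_eq_square)
  finally have w2: "(r + 1) / (r - 1) = inverse (w\<^sup>2)" by simp
  have "p_fun x = inverse (w\<^sup>2) powr (sqrt 2 / 4)" unfolding p_fun_def r_def[symmetric] w2 ..
  also have "\<dots> = w powr (- (2 * (sqrt 2 / 4)))"
    using w_pos by (simp add: powr_def ln_inverse ln_realpow)
  also have "2 * (sqrt 2 / 4) = 1 / sqrt 2" by (simp add: field_simps)
  finally have p: "p_fun x = w powr (- (1 / sqrt 2))" .
  then show "(- sin y / (1 + cos y)) powr (- (1 / sqrt 2)) = p_fun x" by (simp add: w_def)
  show "(- sin y / (1 + cos y)) powr (1 / sqrt 2) = inverse (p_fun x)"
    unfolding w_def[symmetric] p by (simp add: powr_minus)
qed

section \<open>The closed forms\<close>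

text \<open>
  The sequences \<open>T\<^sup>+\<close> and \<open>T\<^sup>-\<close> of the introduction, named after the sign of \<open>e\<close> with which
  \<open>taylor_term_derivative\<close> applies to them.
\<close>

abbreviation pos_branch :: "nat \<Rightarrow> real \<Rightarrow> real" where
  "pos_branch \<equiv> taylor_term p_fun (F_complex (1 / sqrt 2))"

abbreviation neg_branch :: "nat \<Rightarrow> real \<Rightarrow> real" where
  "neg_branch \<equiv> taylor_term (\<lambda>x. inverse (p_fun x)) (F_complex (- (1 / sqrt 2)))"

lemma arctan_angle_bounds:
  assumes "x > 1 / 2"
  shows "- pi < - arctan (sqrt (2 * x - 1))" and "- arctan (sqrt (2 * x - 1)) < 0"
proof -
  show "- pi < - arctan (sqrt (2 * x - 1))" using arctan_ubound[of "sqrt (2 * x - 1)"] pi_gt_zero by linarith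
  show "- arctan (sqrt (2 * x - 1)) < 0" using assms by simp
qed

lemma taylor_term_0:
  assumes "x > 1 / 2"
  shows "pos_branch 0 x = sqrt x / 2" and "neg_branch 0 x = sqrt x / 2"
proof -
  note h = half_angle_value[OF assms]
  have p: "p_fun x \<noteq> 0" using p_fun_pos[OF assms] by simp
  have eq: "taylor_term P (F_complex a) 0 x = P x / 2 * (sqrt x * (- sin y / (1 + cos y)) powr a)"
    if "y = - arctan (sqrt (2 * x - 1))" for P a y
  proof -
    have "taylor_term P (F_complex a) 0 x =
        P x / 2 * (sqrt (2 * x - 1) * (- 1 / (sqrt 2 * sin y)) * (- sin y / (1 + cos y)) powr a)"
      unfolding taylor_term_def that F_complex_of_real[OF arctan_angle_bounds[OF assms]]
      by (simp only: power_Suc0_right times_divide_eq_left mult_ac)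
    then show ?thesis unfolding that h(1) .
  qed
  show "pos_branch 0 x = sqrt x / 2" unfolding eq[OF refl] h(2) using p by simp
  show "neg_branch 0 x = sqrt x / 2" unfolding eq[OF refl] h(3) using p by simp
qed

text \<open>
  The induction step differentiates the identities for \<open>n\<close> as functions on \<open>x > 1 / 2\<close> and compares
  with the recurrences. With the factor \<open>sqrt x\<close> the system becomes diagonal, the branches being
  \<open>(sqrt x * R_pos \<mp> R_neg) / 2\<close>; and \<open>2 * x * (1 - 2 * x)\<close> times the derivative of \<open>sqrt x\<close> is
  \<open>(1 - 2 * x) * sqrt x\<close>, which accounts for the difference between \<open>1 + 2 * n * x\<close> and
  \<open>2 * (n + 1) * x\<close>.
\<close>

lemma R_closed_form:
  "x > 1 / 2 \<Longrightarrow> sqrt x * poly (R_pos n) x = pos_branch n x + neg_branch n x \<and>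
    poly (R_neg n) x = neg_branch n x - pos_branch n x"
proof (induction n arbitrary: x)
  case 0
  then show ?case unfolding taylor_term_0[OF 0] by (simp add: R_pos_def R_neg_def)
next
  case (Suc n)
  define q where "q = sqrt x"
  have q: "q > 0" "x = q\<^sup>2" using Suc.prems by (simp_all add: q_def)
  note an = F_complex_analytic[OF arctan_angle_bounds[OF Suc.prems]]
  have dp: "(p_fun has_real_derivative 1 * p_fun x / (2 * sqrt x * (1 - 2 * x))) (at x)"
    using p_fun_derivative[OF Suc.prems] by simp
  obtain D1 where D1: "(pos_branch n has_real_derivative D1) (at x)"
      "2 * x * (1 - 2 * x) * D1 = pos_branch (Suc n) x - (2 * x * (real n + 1) - 1 * sqrt x) * pos_branch n x"
    using taylor_term_derivative[OF Suc.prems dp an] .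
  obtain D2 where D2: "(neg_branch n has_real_derivative D2) (at x)"
      "2 * x * (1 - 2 * x) * D2 = neg_branch (Suc n) x - (2 * x * (real n + 1) - (- 1) * sqrt x) * neg_branch n x"
    using taylor_term_derivative[OF Suc.prems inverse_p_fun_derivative[OF Suc.prems] an] .
  have "((\<lambda>y. sqrt y * poly (R_pos n) y) has_real_derivative D1 + D2) (at x)"
    using DERIV_add[OF D1(1) D2(1)]
    by (rule has_field_derivative_transform_within_open[where S = "{1/2<..}"])
      (use Suc.prems Suc.IH in auto)
  moreover have "((\<lambda>y. sqrt y * poly (R_pos n) y) has_real_derivative
      inverse q / 2 * poly (R_pos n) x + poly (pderiv (R_pos n)) x * q) (at x)"
    unfolding q_def using Suc.prems by (intro DERIV_mult DERIV_real_sqrt poly_DERIV) simp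
  ultimately have "D1 + D2 = inverse q / 2 * poly (R_pos n) x + poly (pderiv (R_pos n)) x * q"
    by (rule DERIV_unique)
  then have "2 * x * (1 - 2 * x) * D1 + 2 * x * (1 - 2 * x) * D2 =
      2 * x * (1 - 2 * x) * (inverse q / 2 * poly (R_pos n) x + poly (pderiv (R_pos n)) x * q)"
    by (simp flip: distrib_left)
  also have "\<dots> = (1 - 2 * x) * (q * poly (R_pos n) x) + 2 * x * (1 - 2 * x) * poly (pderiv (R_pos n)) x * q"
    using q by (simp add: field_simps power2_eq_square)
  finally have pos: "2 * x * (1 - 2 * x) * D1 + 2 * x * (1 - 2 * x) * D2 =
    (1 - 2 * x) * (q * poly (R_pos n) x) + 2 * x * (1 - 2 * x) * poly (pderiv (R_pos n)) x * q" .
  have "(poly (R_neg n) has_real_derivative D2 - D1) (at x)"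
    using DERIV_diff[OF D2(1) D1(1)]
    by (rule has_field_derivative_transform_within_open[where S = "{1/2<..}"])
      (use Suc.prems Suc.IH in auto)
  from DERIV_unique[OF poly_DERIV this] 
  have neg: "2 * x * (1 - 2 * x) * poly (pderiv (R_neg n)) x =
      2 * x * (1 - 2 * x) * D2 - 2 * x * (1 - 2 * x) * D1"
    by (simp add: right_diff_distrib)
  have IH1: "q * poly (R_pos n) x = pos_branch n x + neg_branch n x"
    and IH2: "poly (R_neg n) x = neg_branch n x - pos_branch n x"
    using Suc.IH[OF Suc.prems] by (simp_all add: q_def)
  have qq: "x * poly (R_pos n) x = q * (pos_branch n x + neg_branch n x)"
    unfolding IH1[symmetric] using q(2) by (simp add: power2_eq_square)
  have "q * poly (R_pos (Suc n)) x = q * poly (R_pos n) x + 2 * x * (1 - 2 * x) * poly (pderiv (R_pos n)) x * q +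
     2 * real n * x * (q * poly (R_pos n) x) + q * poly (R_neg n) x"
    unfolding R_pos_Suc by (simp only: ring_distribs mult_ac)
  also have "\<dots> = pos_branch (Suc n) x + neg_branch (Suc n) x"
    using pos unfolding IH1 IH2 D1(2) D2(2) q_def[symmetric] by (simp add: algebra_simps)
  finally have "sqrt x * poly (R_pos (Suc n)) x = pos_branch (Suc n) x + neg_branch (Suc n) x"
    by (simp add: q_def)
  moreover have "poly (R_neg (Suc n)) x = neg_branch (Suc n) x - pos_branch (Suc n) x"
    unfolding R_neg_Suc neg qq unfolding IH2 D1(2) D2(2) q_def[symmetric] by (simp add: algebra_simps)
  ultimately show ?case by blast
qed

lemma has_fps_expansion_F:
  assumes x: "x > 1 / 2" and F: "\<And>y. F y = - 1 / (sqrt 2 * sin y) * (- sin y / (1 + cos y)) powr a"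
  shows "(\<lambda>t. F (u_fun x t)) has_fps_expansion
    Abs_fps (\<lambda>n. sqrt (2 * x - 1) ^ n * real_higher_deriv (F_complex a) n (- arctan (sqrt (2 * x - 1))) / fact n)"
proof -
  let ?y = "- arctan (sqrt (2 * x - 1))" and ?s = "sqrt (2 * x - 1)"
  note b = arctan_angle_bounds[OF x]
  have u: "u_fun x t = ?y + ?s * t" for t by (simp add: u_fun_def)
  have "((\<lambda>t. ?y + ?s * t) \<longlongrightarrow> ?y + ?s * 0) (nhds 0)"
    by (intro tendsto_intros filterlim_ident)
  then have lim: "((\<lambda>t. ?y + ?s * t) \<longlongrightarrow> ?y) (nhds 0)" by simp
  have "eventually (\<lambda>t. - pi < ?y + ?s * t) (nhds 0)" using order_tendstoD(1)[OF lim b(1)] .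
  moreover have "eventually (\<lambda>t. ?y + ?s * t < 0) (nhds 0)" using order_tendstoD(2)[OF lim b(2)] .
  ultimately have "eventually (\<lambda>t. real_higher_deriv (F_complex a) 0 (?y + ?s * t) = F (u_fun x t)) (nhds 0)"
    unfolding u by eventually_elim (simp only: F F_complex_of_real)
  then show ?thesis
    using has_fps_expansion_real_higher_deriv[OF F_complex_analytic[OF b, of a], of ?s]
    by (subst (asm) has_fps_expansion_cong) auto
qed

theorem theorem3:
  fixes x :: real
  assumes "x > 1 / 2"
  shows "(\<lambda>t. sqrt (2 * x - 1) / (2 * sqrt x * p_fun x) *
            ((p_fun x)\<^sup>2 * F2 (u_fun x t) + F1 (u_fun x t))) has_fps_expansion egf_pos x \<and>
         (\<lambda>t. - sqrt (2 * x - 1) / (2 * p_fun x) *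
            ((p_fun x)\<^sup>2 * F2 (u_fun x t) - F1 (u_fun x t))) has_fps_expansion egf_neg x"
proof -
  let ?y = "- arctan (sqrt (2 * x - 1))" and ?s = "sqrt (2 * x - 1)"
  define E2 where "E2 = Abs_fps (\<lambda>n. ?s ^ n * real_higher_deriv (F_complex (1 / sqrt 2)) n ?y / fact n)"
  define E1 where "E1 = Abs_fps (\<lambda>n. ?s ^ n * real_higher_deriv (F_complex (- (1 / sqrt 2))) n ?y / fact n)"
  have F2: "(\<lambda>t. F2 (u_fun x t)) has_fps_expansion E2"
    unfolding E2_def by (rule has_fps_expansion_F[OF assms]) (rule F2_def)
  have F1: "(\<lambda>t. F1 (u_fun x t)) has_fps_expansion E1"
    unfolding E1_def by (rule has_fps_expansion_F[OF assms]) (rule F1_def)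
  have p: "p_fun x \<noteq> 0" and q: "sqrt x \<noteq> 0" using p_fun_pos[OF assms] assms by auto
  have branches: "pos_branch n x / fact n = ?s * p_fun x / 2 * fps_nth E2 n"
      "neg_branch n x / fact n = ?s / (2 * p_fun x) * fps_nth E1 n" for n
    using p by (simp_all add: taylor_term_def E1_def E2_def field_simps)
  have "fps_const (?s / (2 * sqrt x * p_fun x)) * (fps_const ((p_fun x)\<^sup>2) * E2 + E1) = egf_pos x"
  proof (rule fps_ext)
    fix n
    have "fps_nth (fps_const (?s / (2 * sqrt x * p_fun x)) * (fps_const ((p_fun x)\<^sup>2) * E2 + E1)) n =
        (?s * p_fun x / 2 * fps_nth E2 n + ?s / (2 * p_fun x) * fps_nth E1 n) / sqrt x"
      using p q by (simp add: field_simps power2_eq_square)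
    also have "\<dots> = (sqrt x * poly (R_pos n) x) / fact n / sqrt x"
      unfolding branches[symmetric] using R_closed_form[OF assms, of n] by (simp add: add_divide_distrib)
    finally show "fps_nth (fps_const (?s / (2 * sqrt x * p_fun x)) * (fps_const ((p_fun x)\<^sup>2) * E2 + E1)) n =
        fps_nth (egf_pos x) n"
      using q by (simp add: egf_pos_def)
  qed
  moreover have "fps_const (- ?s / (2 * p_fun x)) * (fps_const ((p_fun x)\<^sup>2) * E2 - E1) = egf_neg x"
  proof (rule fps_ext)
    fix n
    have "fps_nth (fps_const (- ?s / (2 * p_fun x)) * (fps_const ((p_fun x)\<^sup>2) * E2 - E1)) n =
        ?s / (2 * p_fun x) * fps_nth E1 n - ?s * p_fun x / 2 * fps_nth E2 n"
      using p by (simp add: field_simps power2_eq_square)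
    also have "\<dots> = poly (R_neg n) x / fact n"
      unfolding branches[symmetric] using R_closed_form[OF assms, of n] by (simp add: diff_divide_distrib)
    finally show "fps_nth (fps_const (- ?s / (2 * p_fun x)) * (fps_const ((p_fun x)\<^sup>2) * E2 - E1)) n =
        fps_nth (egf_neg x) n"
      by (simp add: egf_neg_def)
  qed
  moreover have "(\<lambda>t. ?s / (2 * sqrt x * p_fun x) * ((p_fun x)\<^sup>2 * F2 (u_fun x t) + F1 (u_fun x t)))
      has_fps_expansion fps_const (?s / (2 * sqrt x * p_fun x)) * (fps_const ((p_fun x)\<^sup>2) * E2 + E1)"
    by (intro has_fps_expansion_cmult_left has_fps_expansion_add F1 F2)
  moreover have "(\<lambda>t. - ?s / (2 * p_fun x) * ((p_fun x)\<^sup>2 * F2 (u_fun x t) - F1 (u_fun x t)))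
      has_fps_expansion fps_const (- ?s / (2 * p_fun x)) * (fps_const ((p_fun x)\<^sup>2) * E2 - E1)"
    by (intro has_fps_expansion_cmult_left has_fps_expansion_diff F1 F2)
  ultimately show ?thesis by simp
qed

end
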